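(* Let $\mu$ be a partition of $n$, and let $\lambda=(\lambda_1,\ldots,\lambda_r)$ be a partition of $m\le n$. Put $\lambda^{[1]}=(\lambda_2,\ldots,\lambda_r)$. Then $$\chi^{\lambda}_{\mu}(q)=\sum_{\nu}\ \sum_{\tau\in C(\mu;\,m-|\nu|)}(-1)^{m-|\nu|-\lambda_1}\,\frac{q^{\,m-|\nu|-l(\tau)}}{(q-1)^{\,l(\mu)-l(\tau)-l(\mu-\tau)}}\ \chi^{\nu}_{\mu-\tau}(q),$$ where the outer sum runs over all partitions $\nu\subset\lambda^{[1]}$ such that $\lambda^{[1]}/\nu$ is a vertical strip.
   Context: Compositions: a composition $\tau\models k$ is a finite sequence of nonnegative integers with sum $k$; $l(\tau)$ is the number of nonzero entries of $\tau$ (also for partitions). For a partition $\mu$, $\tau\subset\mu$ means $\tau_i\le\mu_i$ for all $i$, and $C(\mu;k)=\{\tau=(\tau_1,\ldots,\tau_{l(\mu)}):\tau\subset\mu,\ \tau\models k\}$. The composition $\mu-\tau=(\mu_1-\tau_1,\mu_2-\tau_2,\ldots)$, when used as a lower index of $\chi$, is regarded as the partition obtained by sorting its nonzero entries into descending order. A skew diagram $\alpha/\beta$ is a vertical strip if $\alpha_i-\beta_i\le 1$ for every $i$ (the empty skew diagram is included). The $q$-rook monoid algebra: let $q$ be an indeterminate. For $n\ge2$, $R_n(q)$ is the unital associative $\mathbb{C}(q)$-algebra with generators $T_1,\ldots,T_{n-1},P_1,\ldots,P_n$ and relations: $(T_i-q)(T_i+1)=0$; $T_iT_j=T_jT_i$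 for $|i-j|>1$; $T_iT_{i+1}T_i=T_{i+1}T_iT_{i+1}$; $T_iP_j=P_jT_i=qP_j$ for $1\le i<j\le n$; $T_iP_j=P_jT_i$ for $1\le j<i\le n-1$; $P_i^2=P_i$; $P_{i+1}=qP_iT_i^{-1}P_i$ for $1\le i\le n-1$. Also $R_0(q)=\mathbb{C}(q)$ and $R_1(q)$ is spanned by $1,P_1$ with $P_1^2=P_1$. This algebra is semisimple, with irreducible characters $\chi^\lambda_{R_n(q)}$ indexed by partitions $\lambda\vdash k$, $0\le k\le n$. For a partition $\mu=(\mu_1,\ldots,\mu_l)\vdash n$ with positive parts, the standard element $T_\mu$ is the product, in increasing order of $j$, of all $T_j$ with $1\le j\le n-1$ and $j\notin\{\mu_1,\mu_1+\mu_2,\ldots,\mu_1+\cdots+\mu_{l-1}\}$. Write $\chi^\lambda_\mu(q)=\chi^\lambda_{R_n(q)}(T_\mu)$, with $n=|\mu|$. The values $\chi^\lambda_\mu(q)$ are determined by the known Frobenius formula (Dieng–Halverson–Poladian), valid for every $\mu\vdash n$, which may be taken as their definition: $$\frac{q^{n}}{(q-1)^{l(\mu)}}\,\hat q_\mu(q^{-1})=\sum_{k=0}^n\sum_{\lambda\vdash k}\chi^\lambda_\mu(q)\,s_\lambda .$$ Here $s_\lambda$ are the Schur functions, $p_n$ the power sums, $\hat p_n=1+p_n$, $\hat q_n(t)$ is defined by $\sum_{n\ge0}\hat q_n(t)z^n=\exp\left(\sum_{n\ge1}\frac{1-t^n}{n}\hat p_nz^n\right)$, and $\hat q_\mu(t)=\hat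 q_{\mu_1}(t)\hat q_{\mu_2}(t)\cdots$. *)

theory Defs
  imports
    "HOL-Computational_Algebra.Computational_Algebra"
    "HOL-Library.Poly_Mapping"
    "HOL-Library.More_List"
    "HOL-Library.FuncSet"
begin

section \<open>Partitions and compositions\<close>

text \<open>Partitions are lists of positive parts; \<^term>\<open>nth_default 0 lam i\<close> is the part
  \<open>\<lambda>\<^sub>i\<^sub>+\<^sub>1\<close>, read as 0 beyond the length.\<close>

definition is_partition :: "nat list \<Rightarrow> bool" where
  "is_partition lam \<longleftrightarrow> sorted_wrt (\<ge>) lam \<and> (\<forall>a\<in>set lam. 0 < a)"

definition partitions :: "nat \<Rightarrow> nat list set" where
  "partitions k = {lam. is_partition lam \<and> sum_list lam = k}"

definition nz_len :: "nat list \<Rightarrow> nat" where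
  "nz_len xs = length (filter (\<lambda>a. a \<noteq> 0) xs)"

definition sub_diagram :: "nat list \<Rightarrow> nat list \<Rightarrow> bool" where
  "sub_diagram nu lam \<longleftrightarrow> (\<forall>i. nth_default 0 nu i \<le> nth_default 0 lam i)"

definition vertical_strip :: "nat list \<Rightarrow> nat list \<Rightarrow> bool" where
  "vertical_strip alpha beta \<longleftrightarrow>
     sub_diagram beta alpha \<and> (\<forall>i. nth_default 0 alpha i - nth_default 0 beta i \<le> 1)"

definition sub_compositions :: "nat list \<Rightarrow> nat \<Rightarrow> nat list set" where
  "sub_compositions mu k =
     {tau. length tau = length mu \<and> sub_diagram tau mu \<and> sum_list tau = k}"

definition comp_diff :: "nat list \<Rightarrow> nat list \<Rightarrow> nat list" where
  "comp_diff mu tau = map2 (-) mu tau"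

definition sort_to_partition :: "nat list \<Rightarrow> nat list" where
  "sort_to_partition xs = rev (sort (filter (\<lambda>a. a \<noteq> 0) xs))"


section \<open>Symmetric polynomials over \<open>\<complex>(q)\<close>\<close>

type_synonym cq = "complex poly fract"

definition qq :: cq where
  "qq = Fract [:0, 1:] 1"

text \<open>Polynomials over \<open>\<complex>(q)\<close> in variables \<open>x\<^sub>0, x\<^sub>1, \<dots>\<close>.  A symmetric function is
  represented by its images in the variables \<open>x\<^sub>0, \<dots>, x\<^sub>N\<^sub>-\<^sub>1\<close> for all \<open>N\<close>, so that two
  symmetric functions are equal iff these images agree for every \<open>N\<close>.\<close>

type_synonym mpoly_cq = "(nat \<Rightarrow>\<^sub>0 nat) \<Rightarrow>\<^sub>0 cq"

definition scal :: "cq \<Rightarrow> mpoly_cq" where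
  "scal c = Poly_Mapping.single 0 c"

definition var :: "nat \<Rightarrow> mpoly_cq" where
  "var i = Poly_Mapping.single (Poly_Mapping.single i 1) 1"

definition diagram :: "nat list \<Rightarrow> (nat \<times> nat) set" where
  "diagram lam = {(i, j). i < length lam \<and> j < lam ! i}"

text \<open>Semistandard Young tableaux with entries in \<open>{0, \<dots>, N - 1}\<close>.\<close>

definition ssyt :: "nat \<Rightarrow> nat list \<Rightarrow> (nat \<times> nat \<Rightarrow> nat) set" where
  "ssyt N lam = {T \<in> diagram lam \<rightarrow>\<^sub>E {..<N}.
     (\<forall>i j. (i, Suc j) \<in> diagram lam \<longrightarrow> T (i, j) \<le> T (i, Suc j)) \<and>
     (\<forall>i j. (Suc i, j) \<in> diagram lam \<longrightarrow> T (i, j) < T (Suc i, j))}"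

definition schur :: "nat \<Rightarrow> nat list \<Rightarrow> mpoly_cq" where
  "schur N lam = (\<Sum>T\<in>ssyt N lam. \<Prod>c\<in>diagram lam. var (T c))"

definition power_sum :: "nat \<Rightarrow> nat \<Rightarrow> mpoly_cq" where
  "power_sum N k = (\<Sum>i<N. var i ^ k)"

definition p_hat :: "nat \<Rightarrow> nat \<Rightarrow> mpoly_cq" where
  "p_hat N k = 1 + power_sum N k"

text \<open>The exponential of a power series with zero constant term.  The library's
  \<^const>\<open>fps_exp\<close> needs coefficients in a field, hence the composition with an
  explicit exponential series.\<close>

definition exp_series :: "mpoly_cq fps \<Rightarrow> mpoly_cq fps" where
  "exp_series F = fps_compose (Abs_fps (\<lambda>k. scal (1 / of_nat (fact k)))) F"

definition q_hat :: "nat \<Rightarrow> cq \<Rightarrow> nat \<Rightarrow> mpoly_cq" where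
  "q_hat N t n = fps_nth
     (exp_series (Abs_fps (\<lambda>k. if k = 0 then 0
                               else scal ((1 - t ^ k) / of_nat k) * p_hat N k))) n"

definition q_hat_part :: "nat \<Rightarrow> cq \<Rightarrow> nat list \<Rightarrow> mpoly_cq" where
  "q_hat_part N t mu = prod_list (map (q_hat N t) mu)"


section \<open>Character values of the q-rook monoid algebra\<close>

definition frobenius_formula :: "nat list \<Rightarrow> (nat list \<Rightarrow> cq) \<Rightarrow> bool" where
  "frobenius_formula mu c \<longleftrightarrow> (\<forall>N.
     scal (qq ^ sum_list mu / (qq - 1) ^ nz_len mu) * q_hat_part N (inverse qq) mu
       = (\<Sum>k = 0..sum_list mu. \<Sum>lam\<in>partitions k. scal (c lam) * schur N lam))"

text \<open>\<open>rook_char lam mu\<close> is \<open>\<chi>\<^sup>\<lambda>\<^sub>\<mu>(q)\<close>, i.e. the value at the standard element \<open>T\<^sub>\<mu>\<close>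
  of the irreducible character of \<open>R\<^sub>n(q)\<close>, \<open>n = |\<mu>|\<close>, indexed by \<open>\<lambda>\<close>; the
  Frobenius formula of Dieng, Halverson and Poladian is taken as its definition.
  Since Schur functions are linearly independent, that formula fixes the values for
  \<open>\<lambda> \<turnstile> k \<le> n\<close>; all other values are set to 0 to make the function unique.\<close>

definition rook_char :: "nat list \<Rightarrow> nat list \<Rightarrow> cq" where
  "rook_char lam mu =
     (THE c. frobenius_formula mu c \<and>
             (\<forall>rho. \<not> (is_partition rho \<and> sum_list rho \<le> sum_list mu) \<longrightarrow> c rho = 0)) lam"

end

theory Submission
  imports Defs
begin

text \<open>A symmetric function is handled through its monomial coefficients, a function \<open>f\<close> on integer
sequences of all lengths.  Write \<open>h\<^sub>k\<^sup>\<bottom>\<close> for the adjoint of multiplication by the complete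
symmetric function \<open>h\<^sub>k\<close>; on monomial coefficients it just fixes one exponent to be \<open>k\<close>.

The recurrence combines two facts.  First, Bernstein's formula
\<open>s\<^sub>\<lambda> = \<Sum>\<^sub>i (-1)\<^sup>i h\<^bsub>a+i\<^esub> e\<^sub>i\<^sup>\<bottom> s\<^bsub>\<lambda>'\<^esub>\<close>, where \<open>a\<close> is the first row of \<open>\<lambda>\<close>, \<open>\<lambda>'\<close> consists of
the other rows and \<open>e\<^sub>i\<^sup>\<bottom>\<close> removes vertical strips of size \<open>i\<close>,
says by adjunction that the coefficient of \<open>s\<^sub>\<lambda>\<close> in \<open>F\<close> is the alternating sum, over the
\<open>\<nu>\<close> for which \<open>\<lambda>' / \<nu>\<close> is a vertical strip, of the coefficient of \<open>s\<^sub>\<nu>\<close> in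
\<open>h\<^sub>k\<^sup>\<bottom> F\<close> with \<open>k = |\<lambda>| - |\<nu>|\<close> (\<open>schur_coeff_row_removal\<close>).  Second, a
new variable \<open>x\<close> multiplies the generating series of the \<open>q_hat N t n\<close> by
\<open>(1 - t x z) / (1 - x z)\<close> (\<open>exp_series_add_variable\<close>), whence
\<open>h\<^sub>k\<^sup>\<bottom> q\<^sub>\<mu> = \<Sum>\<^sub>\<tau> (1 - t)\<^bsup>l(\<tau>)\<^esup> q\<^bsub>\<mu>-\<tau>\<^esub>\<close> over the compositions \<open>\<tau> \<in> C(\<mu>; k)\<close>.  At \<open>t = 1/q\<close> the
normalising factors of the Frobenius formula turn this into the stated weights.

Bernstein's formula is not proved for Schur functions.  Its adjoint is taken as the
definition of a functional \<open>schur_coeff\<close>, and it is then shown that this functional computes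
Schur expansions.  The recursion yields the straightening rule
\<open>schur_coeff_antisymmetric\<close>, and a telescoping sum and a cancellation by straightening yield
the Pieri rule \<open>schur_coeff_pieri\<close>.  On the side of tableaux, removing the largest entry gives
the branching rule \<open>schur_branching\<close>.  Pieri rule and branching rule match term by term, so
\<open>schur_expansion\<close> follows by induction on the number of variables; branching also gives
\<open>schur_linearly_independent\<close>.  Hence the Frobenius formula has exactly one solution,
and the character values are, up to the normalising factor, the Schur coefficients of the Frobenius
series (\<open>rook_char_schur_coeff\<close>).\<close>

section \<open>Schur coefficients by row removal\<close>

text \<open>The alternating sum over all ways to lower some entries by one; the number of lowered entries
is the first argument of \<open>G\<close>.  If \<open>G i be\<close> is the coefficient of \<open>s\<^sub>b\<^sub>e\<close> in \<open>F\<^sub>i\<close>, the value is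
\<open>\<Sum>\<^sub>i (-1)\<^sup>i \<langle>e\<^sub>i\<^sup>\<bottom> s\<^sub>a\<^sub>l, F\<^sub>i\<rangle>\<close>, since \<open>e\<^sub>i\<^sup>\<bottom>\<close> lowers \<open>i\<close> of the entries in all possible ways.\<close>

fun signed_drops :: "(nat \<Rightarrow> int list \<Rightarrow> 'a::comm_ring_1) \<Rightarrow> int list \<Rightarrow> 'a" where
  "signed_drops G [] = G 0 []"
| "signed_drops G (a # al) =
     signed_drops (\<lambda>i be. G i (a # be)) al - signed_drops (\<lambda>i be. G (Suc i) ((a - 1) # be)) al"

lemma signed_drops_cong_sum:
  assumes "\<And>i be. length be = length al \<Longrightarrow> int i + sum_list be = sum_list al \<Longrightarrow> G i be = H i be"
  shows "signed_drops G al = signed_drops H al"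
  using assms
proof (induction al arbitrary: G H)
  case (Cons a al)
  have "signed_drops (\<lambda>i be. G i (a # be)) al = signed_drops (\<lambda>i be. H i (a # be)) al"
    by (rule Cons.IH) (auto intro!: Cons.prems)
  moreover have "signed_drops (\<lambda>i be. G (Suc i) ((a - 1) # be)) al
      = signed_drops (\<lambda>i be. H (Suc i) ((a - 1) # be)) al"
    by (rule Cons.IH) (auto intro!: Cons.prems)
  ultimately show ?case by simp
qed auto

lemma signed_drops_cong [fundef_cong]:
  assumes "al = al'" "\<And>i be. length be = length al' \<Longrightarrow> G i be = H i be"
  shows "signed_drops G al = signed_drops H al'"
  using assms by (auto intro: signed_drops_cong_sum)

lemma signed_drops_diff:
  "signed_drops (\<lambda>i be. G i be - H i be) al = signed_drops G al - signed_drops H al"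
  by (induction al arbitrary: G H) (auto simp: algebra_simps)

lemma signed_drops_uminus: "signed_drops (\<lambda>i be. - G i be) al = - signed_drops G al"
  by (induction al arbitrary: G) (auto simp: algebra_simps)

lemma signed_drops_zero: "signed_drops (\<lambda>i be. 0) al = 0"
  by (induction al) auto

lemma signed_drops_mult: "signed_drops (\<lambda>i be. c * G i be) al = c * signed_drops G al"
  by (induction al arbitrary: G) (auto simp: algebra_simps)

lemma signed_drops_sum:
  "signed_drops (\<lambda>i be. \<Sum>t\<in>A. G t i be) al = (\<Sum>t\<in>A. signed_drops (G t) al)"
  by (induction al arbitrary: G) (auto simp: sum_subtractf)

lemma signed_drops_snoc:
  "signed_drops G (al @ [x]) =
     signed_drops (\<lambda>i be. G i (be @ [x])) al - signed_drops (\<lambda>i be. G (Suc i) (be @ [x - 1])) al"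
proof (induction al arbitrary: G)
  case (Cons a al)
  show ?case by (simp add: Cons.IH)
qed simp

lemma signed_drops_commute:
  "signed_drops (\<lambda>i be. signed_drops (\<lambda>j ga. G i j ga) be) al
     = signed_drops (\<lambda>i be. signed_drops (\<lambda>j ga. G j i ga) be) al"
proof (induction al arbitrary: G)
  case (Cons a al)
  let ?D = "\<lambda>H. signed_drops (\<lambda>i be. signed_drops (\<lambda>j ga. H i j ga) be) al"
  have "signed_drops (\<lambda>i be. signed_drops (\<lambda>j ga. H i j ga) be) (a # al)
      = ?D (\<lambda>i j ga. H i j (a # ga)) - ?D (\<lambda>i j ga. H i (Suc j) ((a - 1) # ga))
        - ?D (\<lambda>i j ga. H (Suc i) j ((a - 1) # ga)) + ?D (\<lambda>i j ga. H (Suc i) (Suc j) ((a - 2) # ga))"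
    for H by (simp add: signed_drops_diff)
  from this[of G] this[of "\<lambda>i j. G j i"] show ?case
    using Cons.IH[of "\<lambda>i j ga. G i j (a # ga)"] Cons.IH[of "\<lambda>i j ga. G i (Suc j) ((a - 1) # ga)"]
      Cons.IH[of "\<lambda>i j ga. G (Suc i) j ((a - 1) # ga)"]
      Cons.IH[of "\<lambda>i j ga. G (Suc i) (Suc j) ((a - 2) # ga)"]
    by simp
qed auto

text \<open>Lowering entries commutes with the exchange \<open>(a, b) \<mapsto> (b - 1, a + 1)\<close> of neighbours, because
\<open>(a - \<epsilon>, b - \<epsilon>')\<close> is exchanged to \<open>(b - 1 - \<epsilon>', a + 1 - \<epsilon>)\<close>: the four choices of
\<open>(\<epsilon>, \<epsilon>')\<close> are permuted and antisymmetry is inherited.\<close>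

lemma signed_drops_antisymmetric:
  assumes "\<And>i q a b s. length q = length p \<Longrightarrow>
             G i (q @ a # b # s) = - G i (q @ (b - 1) # (a + 1) # s)"
  shows "signed_drops G (p @ a # b # s) = - signed_drops G (p @ (b - 1) # (a + 1) # s)"
  using assms
proof (induction p arbitrary: G)
  case Nil
  have *: "G i (x # y # t) = - G i ((y - 1) # (x + 1) # t)" for i x y t
    using Nil[of "[]" i x y t] by simp
  have D: "signed_drops (\<lambda>i be. G (h i) (x # y # be)) s
      = - signed_drops (\<lambda>i be. G (h i) (x' # y' # be)) s"
    if "x' = y - 1" "y' = x + 1" for h :: "nat \<Rightarrow> nat" and x y x' y'
    unfolding signed_drops_uminus[symmetric] that by (intro signed_drops_cong refl *)
  show ?case
    using D[of "b - 1" b "a + 1" a "\<lambda>i. i"] D[of "b - 2" "b - 1" "a + 1" a Suc]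
      D[of "b - 1" b a "a - 1" Suc] D[of "b - 2" "b - 1" a "a - 1" "\<lambda>i. Suc (Suc i)"]
    by simp
next
  case (Cons x p)
  have *: "G i (y # q @ a # b # s) = - G i (y # q @ (b - 1) # (a + 1) # s)"
    if "length q = length p" for i q y a b s
    using Cons.prems[of "y # q" i a b s] that by simp
  have "signed_drops (\<lambda>i be. G (h i) (y # be)) (p @ a # b # s)
      = - signed_drops (\<lambda>i be. G (h i) (y # be)) (p @ (b - 1) # (a + 1) # s)"
    for h :: "nat \<Rightarrow> nat" and y
    by (rule Cons.IH) (rule *)
  from this[of "\<lambda>i. i" x] this[of Suc "x - 1"] show ?case by simp
qed

text \<open>The coefficient of \<open>s\<^sub>a\<^sub>l\<close> in the symmetric function with monomial coefficients \<open>f\<close>.  Fixing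
the first exponent of \<open>f\<close> to \<open>k\<close> gives the monomial coefficients of \<open>h\<^sub>k\<^sup>\<bottom> f\<close>, and the second
equation is the adjoint of Bernstein's formula
\<open>s\<^bsub>(a, al)\<^esub> = \<Sum>\<^sub>i (-1)\<^sup>i h\<^bsub>a+i\<^esub> e\<^sub>i\<^sup>\<bottom> s\<^sub>a\<^sub>l\<close>.
Arbitrary integer sequences are admitted as indices, because lowering the entries of a
partition leads out of the partitions.\<close>

function schur_coeff :: "(int list \<Rightarrow> 'a::comm_ring_1) \<Rightarrow> int list \<Rightarrow> 'a" where
  "schur_coeff f [] = f []"
| "schur_coeff f (a # al) = signed_drops (\<lambda>i be. schur_coeff (\<lambda>ga. f ((a + int i) # ga)) be) al"
  by pat_completeness auto
termination by (relation "measure (\<lambda>(f, al). length al)") auto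

text \<open>Exponents are integers, so polynomiality is the requirement that negative exponents have
coefficient zero; by symmetry it suffices to ask this for the last exponent.\<close>

definition symmetric_coeffs :: "(int list \<Rightarrow> 'a::comm_ring_1) \<Rightarrow> bool" where
  "symmetric_coeffs f \<longleftrightarrow>
     (\<forall>p a b s. f (p @ a # b # s) = f (p @ b # a # s)) \<and> (\<forall>p x. x < 0 \<longrightarrow> f (p @ [x]) = 0)"

lemma symmetric_coeffs_Cons:
  assumes "symmetric_coeffs f" shows "symmetric_coeffs (\<lambda>ga. f (a # ga))"
  using assms unfolding symmetric_coeffs_def by (metis append_Cons)

lemma symmetric_coeffs_swap: "symmetric_coeffs f \<Longrightarrow> f (a # b # s) = f (b # a # s)"
  unfolding symmetric_coeffs_def by (metis append_Nil)

text \<open>The straightening rule for Schur functions indexed by integer sequences.  For the first two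
entries, two unfoldings give \<open>G(a, b) - G(a + 1, b - 1)\<close> with \<open>G\<close> symmetric, because
\<open>h\<^sub>k\<^sup>\<bottom>\<close> and \<open>h\<^sub>l\<^sup>\<bottom>\<close> commute; the exchange only swaps the two terms.\<close>

lemma schur_coeff_antisymmetric:
  assumes "symmetric_coeffs f"
  shows "schur_coeff f (p @ a # b # s) = - schur_coeff f (p @ (b - 1) # (a + 1) # s)"
  using assms
proof (induction "length p" arbitrary: p f a b s)
  case 0
  define G where "G = (\<lambda>a b. signed_drops (\<lambda>i be. signed_drops
      (\<lambda>j ga. schur_coeff (\<lambda>de. f ((a + int i) # (b + int j) # de)) ga) be) s)"
  have c: "schur_coeff f (a # b # s) = G a b - G (a + 1) (b - 1)" for a b
    by (simp add: G_def algebra_simps)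
  have "G a b = G b a" for a b
    unfolding G_def by (subst signed_drops_commute, subst symmetric_coeffs_swap[OF 0(2)], rule refl)
  then have "G a b = G b a" "G (a + 1) (b - 1) = G (b - 1) (a + 1)" by auto
  then show ?case using 0 by (simp add: c del: schur_coeff.simps)
next
  case (Suc n)
  then obtain x q where p: "p = x # q" "n = length q" by (cases p) auto
  show ?case unfolding p append_Cons schur_coeff.simps
    by (rule signed_drops_antisymmetric, rule Suc.hyps(1)[OF _ symmetric_coeffs_Cons[OF Suc.prems]])
      (simp add: p(2))
qed

lemma schur_coeff_neg_last:
  assumes "symmetric_coeffs f" "x < 0"
  shows "schur_coeff f (al @ [x]) = 0"
  using assms
proof (induction "length al" arbitrary: al x f)
  case 0
  then show ?case unfolding symmetric_coeffs_def by (auto dest: spec[of _ "[]"])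
next
  case (Suc n)
  then obtain a be where p: "al = a # be" "n = length be" by (cases al) auto
  have "schur_coeff (\<lambda>ga. f (c # ga)) (de @ [y]) = 0" if "length de = length be" "y < 0" for c de y
    using Suc.hyps(1)[OF _ symmetric_coeffs_Cons[OF Suc.prems(1)]] that p by simp
  then show ?case using Suc.prems(2)
    by (simp add: p signed_drops_snoc signed_drops_zero cong: signed_drops_cong)
qed

text \<open>Stability in the number of variables: in the unfolding, the terms that lower the appended
zero end in \<open>-1\<close> and vanish.\<close>

lemma schur_coeff_append_zero:
  assumes "symmetric_coeffs f" "\<And>al. f (al @ [0]) = f al"
  shows "schur_coeff f (al @ [0]) = schur_coeff f al"
  using assms
proof (induction "length al" arbitrary: al f)
  case 0
  then show ?case using 0(3)[of "[]"] by simp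
next
  case (Suc n)
  then obtain a be where p: "al = a # be" "n = length be" by (cases al) auto
  have 1: "schur_coeff (\<lambda>ga. f (c # ga)) (de @ [0]) = schur_coeff (\<lambda>ga. f (c # ga)) de"
    if "length de = length be" for c de
  proof (rule Suc.hyps(1))
    show "f (c # al @ [0]) = f (c # al)" for al
      using Suc.prems(2)[of "c # al"] by simp
  qed (use that p symmetric_coeffs_Cons[OF Suc.prems(1)] in simp_all)
  have 2: "schur_coeff (\<lambda>ga. f (c # ga)) (de @ [-1]) = 0" for c de
    using schur_coeff_neg_last[OF symmetric_coeffs_Cons[OF Suc.prems(1)]] by simp
  show ?case by (simp add: p signed_drops_snoc signed_drops_zero 1 2 cong: signed_drops_cong)
qed

lemma schur_coeff_cong_sum:
  assumes "\<And>ga. length ga = length al \<Longrightarrow> sum_list ga = sum_list al \<Longrightarrow> f ga = g ga"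
  shows "schur_coeff f al = schur_coeff g al"
  using assms
proof (induction "length al" arbitrary: al f g)
  case (Suc n)
  then obtain a be where p: "al = a # be" "n = length be" by (cases al) auto
  show ?case unfolding p schur_coeff.simps
    by (intro signed_drops_cong_sum Suc.hyps(1)) (auto simp: p intro!: Suc.prems)
qed auto

lemma schur_coeff_sum:
  "schur_coeff (\<lambda>ga. \<Sum>t\<in>A. w t * F t ga) al = (\<Sum>t\<in>A. w t * schur_coeff (F t) al)"
proof (induction "length al" arbitrary: al F)
  case (Suc n)
  then obtain a be where p: "al = a # be" "n = length be" by (cases al) auto
  have "schur_coeff (\<lambda>ga. \<Sum>t\<in>A. w t * F t (c # ga)) de
      = (\<Sum>t\<in>A. w t * schur_coeff (\<lambda>ga. F t (c # ga)) de)"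
    if "length de = length be" for c de
    using Suc.hyps(1)[of de "\<lambda>t ga. F t (c # ga)"] that p by simp
  then show ?case
    by (simp add: p signed_drops_sum signed_drops_mult cong: signed_drops_cong)
qed auto

lemma schur_coeff_zero: "schur_coeff (\<lambda>ga. 0) al = 0"
  using schur_coeff_sum[of "\<lambda>_. 0" "\<lambda>_ _. 0" "{}"] by simp

section \<open>The Pieri rule for Schur coefficients\<close>

text \<open>The sum of \<open>g\<close> over all sequences, with one more entry than \<open>nu\<close>, that lie entrywise above
\<open>nu @ [0]\<close> and exceed it by \<open>k\<close> in total.\<close>

fun above_sum :: "(int list \<Rightarrow> 'a::comm_ring_1) \<Rightarrow> int list \<Rightarrow> nat \<Rightarrow> 'a" where
  "above_sum g [] k = g [int k]"
| "above_sum g (b # nu) k = (\<Sum>j\<le>k. above_sum (\<lambda>be. g ((b + int j) # be)) nu (k - j))"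

lemma above_sum_diff:
  "above_sum (\<lambda>be. g be - h be) nu k = above_sum g nu k - above_sum h nu k"
  by (induction nu arbitrary: g h k) (auto simp: sum_subtractf)

text \<open>In \<open>above_sum\<close>, every entry except the last runs over a range that starts at an entry of
\<open>nu\<close>, so lowering it amounts to lowering that entry of \<open>nu\<close>; lowering the last entry, which starts
at 0, lowers the excess \<open>k\<close>, and the terms where it becomes \<open>-1\<close> vanish by assumption.\<close>

lemma above_sum_signed_drops:
  assumes "\<And>i be x. x < 0 \<Longrightarrow> G i (be @ [x]) = 0"
  shows "above_sum (signed_drops G) nu k =
     signed_drops (\<lambda>i be. above_sum (G i) be k) nu
     - (if k = 0 then 0 else signed_drops (\<lambda>i be. above_sum (G (Suc i)) be (k - 1)) nu)"
  using assms
proof (induction nu arbitrary: G k)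
  case Nil
  then show ?case using Nil[of "-1" 1 "[]"] by (auto simp: of_nat_diff)
next
  case (Cons b nu)
  let ?A = "\<lambda>j r. signed_drops (\<lambda>i be. above_sum (\<lambda>ga. G i ((b + int j) # ga)) be r) nu"
  let ?B = "\<lambda>j r. signed_drops (\<lambda>i be. above_sum (\<lambda>ga. G (Suc i) ((b + int j) # ga)) be r) nu"
  let ?C = "\<lambda>j r. signed_drops (\<lambda>i be. above_sum (\<lambda>ga. G (Suc i) ((b + int j - 1) # ga)) be r) nu"
  let ?D = "\<lambda>j r. signed_drops (\<lambda>i be. above_sum (\<lambda>ga. G (Suc (Suc i)) ((b + int j - 1) # ga)) be r) nu"
  have v: "G i (y # be @ [x]) = 0" if "x < 0" for i be x y
    using Cons.prems[of x i "y # be"] that by simp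
  have last: "(\<Sum>j\<le>k. if k - j = 0 then 0 else F j (k - j - 1)) =
     (if k = 0 then 0 else \<Sum>j\<le>k-1. F j (k - 1 - j))" for F :: "nat \<Rightarrow> nat \<Rightarrow> 'a"
  proof (cases k)
    case (Suc k')
    have "(\<Sum>j\<le>k'. if k - j = 0 then 0 else F j (k - j - 1)) = (\<Sum>j\<le>k'. F j (k' - j))"
      by (rule sum.cong) (auto simp: Suc)
    then show ?thesis by (simp add: Suc)
  qed simp
  have "above_sum (signed_drops G) (b # nu) k =
     (\<Sum>j\<le>k. ?A j (k - j) - (if k - j = 0 then 0 else ?B j (k - j - 1))
        - (?C j (k - j) - (if k - j = 0 then 0 else ?D j (k - j - 1))))"
    unfolding above_sum.simps signed_drops.simps above_sum_diff
    by (intro sum.cong refl arg_cong2[of _ _ _ _ "(-)"] Cons.IH) (auto simp: v)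
  also have "\<dots> = (\<Sum>j\<le>k. ?A j (k - j)) - (if k = 0 then 0 else \<Sum>j\<le>k-1. ?B j (k - 1 - j))
        - ((\<Sum>j\<le>k. ?C j (k - j)) - (if k = 0 then 0 else \<Sum>j\<le>k-1. ?D j (k - 1 - j)))"
    unfolding sum_subtractf last[of ?B] last[of ?D] by (rule refl)
  also have "\<dots> = signed_drops (\<lambda>i be. above_sum (G i) be k) (b # nu)
     - (if k = 0 then 0 else signed_drops (\<lambda>i be. above_sum (G (Suc i)) be (k - 1)) (b # nu))"
    by (simp add: signed_drops_sum algebra_simps)
  finally show ?case .
qed

text \<open>Applied to the row removal recursion, the two terms of
the previous lemma telescope in the first entry: only the term in which the first entry
equals that of \<open>nu\<close> survives.  This amounts to cancelling the factors \<open>1 - x\<^sub>N/x\<^sub>i\<close> of the Vandermonde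
product against geometric series.\<close>

lemma above_sum_schur_coeff:
  assumes "symmetric_coeffs f"
  shows "above_sum (schur_coeff f) nu k = schur_coeff (\<lambda>ga. f (int k # ga)) nu"
  using assms
proof (induction "length nu" arbitrary: nu f k)
  case (Suc n)
  then obtain b nu' where p: "nu = b # nu'" "n = length nu'" by (cases nu) auto
  let ?F = "\<lambda>c. schur_coeff (\<lambda>ga. f (c # ga))"
  let ?t = "\<lambda>j. signed_drops (\<lambda>i be. above_sum (?F (b + int j + int i)) be (k - j)) nu'"
  have v: "?F c (be @ [x]) = 0" if "x < 0" for c be x
    using schur_coeff_neg_last[OF symmetric_coeffs_Cons[OF Suc.prems]] that by simp
  have "above_sum (schur_coeff f) nu k
      = (\<Sum>j\<le>k. above_sum (signed_drops (\<lambda>i be. ?F (b + int j + int i) be)) nu' (k - j))"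
    by (simp add: p)
  also have "\<dots> = (\<Sum>j\<le>k. ?t j - (if k - j = 0 then 0 else ?t (Suc j)))"
  proof (rule sum.cong[OF refl])
    fix j assume "j \<in> {..k}"
    show "above_sum (signed_drops (\<lambda>i be. ?F (b + int j + int i) be)) nu' (k - j)
       = ?t j - (if k - j = 0 then 0 else ?t (Suc j))"
      by (subst above_sum_signed_drops) (auto simp: v algebra_simps)
  qed
  also have "\<dots> = (\<Sum>j\<le>k. ?t j) - (\<Sum>j<k. ?t (Suc j))"
  proof -
    have "(\<Sum>j\<le>k. if k - j = 0 then 0 else ?t (Suc j)) = (\<Sum>j<k. ?t (Suc j))"
      by (rule sum.mono_neutral_cong_right) auto
    then show ?thesis by (simp only: sum_subtractf)
  qed
  also have "\<dots> = ?t 0"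
    by (simp only: sum.atMost_shift) simp
  also have "\<dots> = signed_drops (\<lambda>i be. schur_coeff (\<lambda>ga. f ((b + int i) # int k # ga)) be) nu'"
    using p Suc.hyps(1)[OF _ symmetric_coeffs_Cons[OF Suc.prems]]
    by (intro signed_drops_cong refl) simp
  also have "\<dots> = schur_coeff (\<lambda>ga. f (int k # ga)) nu"
    unfolding p schur_coeff.simps by (subst symmetric_coeffs_swap[OF Suc.prems]) (rule refl)
  finally show ?case .
qed auto

instance fract :: ("{idom, ring_char_0}") ring_char_0
proof
  show "inj (of_nat :: nat \<Rightarrow> 'a fract)"
    by (auto simp: inj_on_def Fract_of_nat_eq [symmetric] eq_fract)
qed

text \<open>The part of \<open>above_sum\<close> in which each entry is bounded by the preceding entry of
\<open>nu\<close>, and the first one by \<open>u\<close>.\<close>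

fun interlacing_sum :: "int \<Rightarrow> (int list \<Rightarrow> 'a::comm_ring_1) \<Rightarrow> int list \<Rightarrow> nat \<Rightarrow> 'a" where
  "interlacing_sum u g [] k = (if int k \<le> u then g [int k] else 0)"
| "interlacing_sum u g (b # nu) k =
     (\<Sum>j | j \<le> k \<and> b + int j \<le> u. interlacing_sum b (\<lambda>be. g ((b + int j) # be)) nu (k - j))"

lemma interlacing_sum_uminus:
  "interlacing_sum u (\<lambda>be. - g be) nu k = - interlacing_sum u g nu k"
  by (induction nu arbitrary: u g k) (auto simp: sum_negf)

lemma eq_uminus_imp_zero:
  fixes x :: "'a::{idom, ring_char_0}"
  assumes "x = - x" shows "x = 0"
proof -
  have "2 * x = 0"
    unfolding mult_2 using assms[unfolded eq_neg_iff_add_eq_0] .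
  then show ?thesis by simp
qed

text \<open>The terms whose second entry exceeds \<open>b\<close> cancel in pairs: exchanging
\<open>(x, y) \<mapsto> (y - 1, x + 1)\<close> preserves the conditions \<open>x \<ge> b\<close> and \<open>y > b\<close>.\<close>

lemma swap_cancel:
  fixes h :: "int \<Rightarrow> int \<Rightarrow> nat \<Rightarrow> 'a::{idom, ring_char_0}"
  assumes anti: "\<And>x y r. h x y r = - h (y - 1) (x + 1) r" and "b' \<le> b"
  shows "(\<Sum>j\<le>k. \<Sum>i\<le>k - j. h (b + int j) (b' + int i) (k - j - i))
       = (\<Sum>j\<le>k. \<Sum>i | i \<le> k - j \<and> b' + int i \<le> b. h (b + int j) (b' + int i) (k - j - i))"
proof -
  let ?h = "\<lambda>(j, i). h (b + int j) (b' + int i) (k - j - i)"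
  define B where "B = (SIGMA j:{..k}. {i. i \<le> k - j \<and> \<not> b' + int i \<le> b})"
  \<comment> \<open>the exchange, in terms of the excesses \<open>j = x - b\<close> and \<open>i = y - b'\<close>\<close>
  define \<phi> where "\<phi> = (\<lambda>(j, i). (nat (b' + int i - 1 - b), nat (b + int j + 1 - b')))"
  have "sum ?h B = (\<Sum>x\<in>B. - ?h x)"
  proof (rule sum.reindex_bij_witness[of _ \<phi> \<phi>], goal_cases)
    case (5 x)
    then obtain j i where x: "x = (j, i)" "j \<le> k" "i \<le> k - j" "b' + int i > b"
      by (auto simp: B_def)
    have "b + int (nat (b' + int i - 1 - b)) = b' + int i - 1"
      and "b' + int (nat (b + int j + 1 - b')) = b + int j + 1"
      and "k - nat (b' + int i - 1 - b) - nat (b + int j + 1 - b') = k - j - i"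
      using x assms(2) by auto
    then have "- ?h (\<phi> x) = - h (b' + int i - 1) (b + int j + 1) (k - j - i)"
      by (simp add: x(1) \<phi>_def)
    also have "\<dots> = ?h x"
      by (simp only: x(1) prod.case anti[of "b + int j" "b' + int i" "k - j - i"])
    finally show ?case .
  qed (use assms(2) in \<open>auto simp: B_def \<phi>_def\<close>)
  then have neg: "sum ?h B = - sum ?h B"
    unfolding sum_negf .
  have 0: "sum ?h B = 0"
    by (rule eq_uminus_imp_zero) (rule neg)
  have "(\<Sum>j\<le>k. \<Sum>i\<le>k - j. h (b + int j) (b' + int i) (k - j - i))
      = sum ?h (SIGMA j:{..k}. {..k-j})"
    by (simp add: sum.Sigma)
  also have "(SIGMA j:{..k}. {..k-j}) = (SIGMA j:{..k}. {i. i \<le> k - j \<and> b' + int i \<le> b}) \<union> B"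
    by (auto simp: B_def)
  also have "sum ?h \<dots> = sum ?h (SIGMA j:{..k}. {i. i \<le> k - j \<and> b' + int i \<le> b}) + sum ?h B"
    by (rule sum.union_disjoint) (auto simp: B_def)
  also have "\<dots> = (\<Sum>j\<le>k. \<Sum>i | i \<le> k - j \<and> b' + int i \<le> b. h (b + int j) (b' + int i) (k - j - i))"
    unfolding 0 add_0_right by (rule sum.Sigma[symmetric]) auto
  finally show ?thesis .
qed

text \<open>For an antisymmetric \<open>g\<close> everything outside the interlacing sequences cancels.  The tail is
reduced to interlacing form by induction, and then its first entry can only violate the bound
by the head, which is the situation of \<open>swap_cancel\<close>.\<close>

lemma above_sum_antisymmetric:
  fixes g :: "int list \<Rightarrow> 'a::{idom, ring_char_0}"
  assumes "\<And>p x y s. g (p @ x # y # s) = - g (p @ (y - 1) # (x + 1) # s)"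
    and "sorted_wrt (\<ge>) (b # nu)" "\<forall>x\<in>set (b # nu). 0 \<le> x"
  shows "above_sum g (b # nu) k
       = (\<Sum>j\<le>k. interlacing_sum b (\<lambda>be. g ((b + int j) # be)) nu (k - j))"
  using assms
proof (induction nu arbitrary: g b k)
  case Nil
  \<comment> \<open>There is no free tail here, so a dummy excess \<open>r\<close>, forced to be zero, gives the sum the shape of \<open>swap_cancel\<close>.\<close>
  define h where "h = (\<lambda>x y r. if r = (0::nat) then g [x, y] else 0)"
  have h: "h x y r = - h (y - 1) (x + 1) r" for x y r
    using Nil.prems(1)[of "[]" x y "[]"] by (auto simp: h_def)
  have "above_sum g [b] k = (\<Sum>j\<le>k. \<Sum>i\<le>k - j. h (b + int j) (0 + int i) (k - j - i))"
    unfolding above_sum.simps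
  proof (rule sum.cong[OF refl])
    fix j assume "j \<in> {..k}"
    have "(\<Sum>i\<le>k - j. h (b + int j) (0 + int i) (k - j - i))
        = (\<Sum>i\<in>{k - j}. h (b + int j) (0 + int i) (k - j - i))"
      by (rule sum.mono_neutral_right) (auto simp: h_def)
    then show "g [b + int j, int (k - j)] = (\<Sum>i\<le>k - j. h (b + int j) (0 + int i) (k - j - i))"
      by (simp add: h_def)
  qed
  also have "\<dots> = (\<Sum>j\<le>k. \<Sum>i | i \<le> k - j \<and> 0 + int i \<le> b. h (b + int j) (0 + int i) (k - j - i))"
    by (rule swap_cancel, rule h) (use Nil.prems in auto)
  also have "\<dots> = (\<Sum>j\<le>k. interlacing_sum b (\<lambda>be. g ((b + int j) # be)) [] (k - j))"
  proof (rule sum.cong[OF refl])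
    fix j assume j: "j \<in> {..k}"
    have "(\<Sum>i | i \<le> k - j \<and> 0 + int i \<le> b. h (b + int j) (0 + int i) (k - j - i))
        = (\<Sum>i\<in>{i. i = k - j \<and> int i \<le> b}. h (b + int j) (int i) (k - j - i))"
      by (rule sum.mono_neutral_cong_right) (auto simp: h_def)
    also have "{i. i = k - j \<and> int i \<le> b} = (if int (k - j) \<le> b then {k - j} else {})"
      by auto
    finally show "(\<Sum>i | i \<le> k - j \<and> 0 + int i \<le> b. h (b + int j) (0 + int i) (k - j - i))
        = interlacing_sum b (\<lambda>be. g ((b + int j) # be)) [] (k - j)"
      using j by (simp add: h_def)
  qed
  finally show ?case .
next
  case (Cons b' nu)
  define h where "h = (\<lambda>x y r. interlacing_sum b' (\<lambda>be. g (x # y # be)) nu r)"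
  have h: "h x y r = - h (y - 1) (x + 1) r" for x y r
  proof -
    have "(\<lambda>be. g (x # y # be)) = (\<lambda>be. - g ((y - 1) # (x + 1) # be))"
      using Cons.prems(1)[of "[]" x y] by auto
    then show ?thesis by (simp add: h_def interlacing_sum_uminus)
  qed
  have "above_sum g (b # b' # nu) k = (\<Sum>j\<le>k. above_sum (\<lambda>be. g ((b + int j) # be)) (b' # nu) (k - j))"
    by simp
  also have "\<dots> = (\<Sum>j\<le>k. \<Sum>i\<le>k - j. h (b + int j) (b' + int i) (k - j - i))"
    unfolding h_def
  proof (rule sum.cong[OF refl], rule Cons.IH)
    fix j p x y s
    show "g ((b + int j) # p @ x # y # s) = - g ((b + int j) # p @ (y - 1) # (x + 1) # s)"
      using Cons.prems(1)[of "(b + int j) # p" x y s] by simp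
  qed (use Cons.prems in auto)
  also have "\<dots> = (\<Sum>j\<le>k. \<Sum>i | i \<le> k - j \<and> b' + int i \<le> b. h (b + int j) (b' + int i) (k - j - i))"
    by (rule swap_cancel, rule h) (use Cons.prems in auto)
  also have "\<dots> = (\<Sum>j\<le>k. interlacing_sum b (\<lambda>be. g ((b + int j) # be)) (b' # nu) (k - j))"
    by (simp add: h_def)
  finally show ?case .
qed

text \<open>Equivalently, \<open>lam / nu\<close> is a horizontal strip and \<open>lam\<close> has one more, possibly zero, row
than \<open>nu\<close>.\<close>

definition interlaces :: "nat list \<Rightarrow> nat list \<Rightarrow> bool" where
  "interlaces nu lam \<longleftrightarrow> length lam = Suc (length nu) \<and>
     (\<forall>i<length nu. lam ! Suc i \<le> nu ! i \<and> nu ! i \<le> lam ! i)"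

lemma interlaces_Nil: "interlaces [] lam \<longleftrightarrow> (\<exists>a. lam = [a])"
  by (auto simp: interlaces_def length_Suc_conv)

lemma interlaces_Cons:
  "interlaces (b # nu) (a # lam) \<longleftrightarrow> b \<le> a \<and> lam ! 0 \<le> b \<and> interlaces nu lam"
  unfolding interlaces_def by (auto simp: All_less_Suc2)

lemma finite_interlaces: "finite {lam. interlaces nu lam \<and> P lam \<and> sum_list lam = s}"
proof (rule finite_subset[OF _ finite_lists_length_eq[of "{..s}" "Suc (length nu)"]])
  show "{lam. interlaces nu lam \<and> P lam \<and> sum_list lam = s}
      \<subseteq> {xs. set xs \<subseteq> {..s} \<and> length xs = Suc (length nu)}"
    by (auto simp: interlaces_def intro: member_le_sum_list)
qed simp

lemma interlaces_sum_le: "interlaces nu lam \<Longrightarrow> sum_list nu \<le> sum_list lam"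
proof (induction nu arbitrary: lam)
  case (Cons c nu)
  then obtain a lam' where "lam = a # lam'" by (auto simp: interlaces_def length_Suc_conv)
  with Cons show ?case by (auto simp: interlaces_Cons add_mono)
qed auto

lemma interlacing_sum_eq:
  "interlacing_sum u g (map int nu) k
     = (\<Sum>lam | interlaces nu lam \<and> int (lam ! 0) \<le> u \<and> sum_list lam = sum_list nu + k. g (map int lam))"
proof (induction nu arbitrary: u g k)
  case Nil
  have "{lam. interlaces [] lam \<and> int (lam ! 0) \<le> u \<and> sum_list lam = k} = (if int k \<le> u then {[k]} else {})"
    by (auto simp: interlaces_Nil)
  then show ?case by simp
next
  case (Cons b nu)
  let ?S = "\<lambda>j. {lam. interlaces nu lam \<and> int (lam ! 0) \<le> int b \<and> sum_list lam = sum_list nu + (k - j)}"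
  have "interlacing_sum u g (map int (b # nu)) k
      = (\<Sum>j | j \<le> k \<and> int b + int j \<le> u. \<Sum>lam\<in>?S j. g ((int b + int j) # map int lam))"
    by (simp add: Cons.IH)
  also have "\<dots> = (\<Sum>(j, lam)\<in>(SIGMA j:{j. j \<le> k \<and> int b + int j \<le> u}. ?S j). g ((int b + int j) # map int lam))"
    by (rule sum.Sigma) (auto intro: finite_interlaces)
  also have "\<dots> = (\<Sum>lam | interlaces (b # nu) lam \<and> int (lam ! 0) \<le> u
      \<and> sum_list lam = sum_list (b # nu) + k. g (map int lam))"
  proof (rule sum.reindex_bij_witness[of _ "\<lambda>lam. (hd lam - b, tl lam)" "\<lambda>(j, lam). (b + j) # lam"], goal_cases)
    case (4 lam)
    then obtain a lam' where [simp]: "lam = a # lam'" by (auto simp: interlaces_def length_Suc_conv)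
    with 4 interlaces_sum_le[of nu lam'] show ?case by (auto simp: interlaces_Cons)
  next
    case (3 lam)
    then show ?case by (cases lam) (auto simp: interlaces_Cons interlaces_def)
  next
    case (2 x)
    then show ?case by (auto simp: interlaces_Cons)
  next
    case (5 x)
    then show ?case by auto
  next
    case (1 lam)
    then show ?case by (cases lam) (auto simp: interlaces_Cons interlaces_def)
  qed
  finally show ?case .
qed

text \<open>The adjoint of the Pieri rule \<open>h\<^sub>k s\<^sub>\<nu> = \<Sum> s\<^sub>\<lambda>\<close> over horizontal strips \<open>\<lambda>/\<nu>\<close> of
size \<open>k\<close>.\<close>

theorem schur_coeff_pieri:
  fixes f :: "int list \<Rightarrow> 'a::{idom, ring_char_0}"
  assumes f: "symmetric_coeffs f" and nu: "sorted_wrt (\<ge>) nu"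
  shows "schur_coeff (\<lambda>ga. f (int k # ga)) (map int nu)
    = (\<Sum>lam | interlaces nu lam \<and> sum_list lam = sum_list nu + k. schur_coeff f (map int lam))"
proof -
  have "above_sum (schur_coeff f) (map int nu) k
      = interlacing_sum (int (sum_list nu + k)) (schur_coeff f) (map int nu) k"
  proof (cases nu)
    case (Cons b nu')
    have "above_sum (schur_coeff f) (map int nu) k = (\<Sum>j\<le>k.
        interlacing_sum (int b) (\<lambda>be. schur_coeff f ((int b + int j) # be)) (map int nu') (k - j))"
      unfolding Cons list.map using nu
      by (intro above_sum_antisymmetric schur_coeff_antisymmetric f)
        (auto simp: Cons sorted_wrt_map)
    also have "{..k} = {j. j \<le> k \<and> int b + int j \<le> int (sum_list nu + k)}"
      by (auto simp: Cons)
    finally show ?thesis unfolding Cons list.map interlacing_sum.simps .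
  qed simp
  also have "\<dots> = (\<Sum>lam | interlaces nu lam \<and> sum_list lam = sum_list nu + k. schur_coeff f (map int lam))"
    unfolding interlacing_sum_eq
  proof (rule sum.cong[OF _ refl])
    have "int (lam ! 0) \<le> int (sum_list nu + k)"
      if "interlaces nu lam" "sum_list lam = sum_list nu + k" for lam
      using that member_le_sum_list[of "lam ! 0" lam] by (auto simp: interlaces_def)
    then show "{lam. interlaces nu lam \<and> int (lam ! 0) \<le> int (sum_list nu + k) \<and>
        sum_list lam = sum_list nu + k} = {lam. interlaces nu lam \<and> sum_list lam = sum_list nu + k}"
      by blast
  qed
  finally show ?thesis by (simp add: above_sum_schur_coeff[OF f])
qed

section \<open>Branching of Schur polynomials\<close>

lemma diagram_Sigma: "diagram lam = (SIGMA i:{..<length lam}. {..<lam ! i})"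
  by (auto simp: diagram_def)

lemma finite_diagram: "finite (diagram lam)"
  by (simp add: diagram_Sigma)

lemma card_diagram: "card (diagram lam) = sum_list lam"
  by (simp add: diagram_Sigma sum_list_sum_nth atLeast0LessThan)

lemma finite_ssyt: "finite (ssyt N lam)"
  by (rule finite_subset[OF _ finite_PiE[OF finite_diagram[of lam], of "\<lambda>_. {..<N}"]])
    (auto simp: ssyt_def)

text \<open>Columns increase strictly from an entry that is at least 0.  So a shape with more than
\<open>N\<close> rows has no tableau, and in a shape with \<open>N + 1\<close> rows the last row of a tableau with
entries up to \<open>N\<close> is constant.\<close>

lemma row_le_ssyt_entry:
  assumes "T \<in> ssyt N lam" "sorted_wrt (\<ge>) lam" "(i, j) \<in> diagram lam"
  shows "i \<le> T (i, j)"
  using assms(3)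
proof (induction i)
  case (Suc i)
  then have "(i, j) \<in> diagram lam"
    using sorted_wrt_nth_less[OF assms(2), of i "Suc i"] by (auto simp: diagram_def)
  with Suc assms(1) show ?case by (fastforce simp: ssyt_def)
qed simp

lemma ssyt_less: "T \<in> ssyt N lam \<Longrightarrow> c \<in> diagram lam \<Longrightarrow> T c < N"
  by (auto simp: ssyt_def)

lemma schur_too_long:
  assumes "is_partition lam" "N < length lam"
  shows "schur N lam = 0"
proof -
  have "T \<notin> ssyt N lam" for T
  proof
    assume T: "T \<in> ssyt N lam"
    have "(N, 0) \<in> diagram lam"
      using assms by (auto simp: diagram_def is_partition_def)
    with T row_le_ssyt_entry[OF T] ssyt_less[OF T] assms show False
      by (fastforce simp: is_partition_def)
  qed
  then have "ssyt N lam = {}" by blast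
  then show ?thesis by (simp add: schur_def)
qed

lemma ssyt_row_mono:
  assumes "T \<in> ssyt N lam" "(i, j') \<in> diagram lam" "j \<le> j'"
  shows "T (i, j) \<le> T (i, j')"
  using assms(3,2)
proof (induction j' rule: dec_induct)
  case (step k)
  then have "(i, k) \<in> diagram lam" by (auto simp: diagram_def)
  with step assms(1) show ?case by (fastforce simp: ssyt_def)
qed simp

lemma interlaces_length: "interlaces nu lam \<Longrightarrow> length lam = Suc (length nu)"
  by (simp add: interlaces_def)

lemma finite_interlaced: "finite {nu. interlaces nu lam}"
proof (rule finite_subset[OF _ finite_lists_length_eq[of "{..sum_list lam}" "length lam - 1"]])
  show "{nu. interlaces nu lam} \<subseteq> {xs. set xs \<subseteq> {..sum_list lam} \<and> length xs = length lam - 1}"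
  proof safe
    fix nu x assume *: "interlaces nu lam" "x \<in> set nu"
    then obtain i where "i < length nu" "x = nu ! i" by (auto simp: in_set_conv_nth)
    with * have "x \<le> lam ! i" "lam ! i \<in> set lam" by (auto simp: interlaces_def)
    then show "x \<le> sum_list lam" using member_le_sum_list[of "lam ! i" lam] by simp
  qed (simp add: interlaces_def)
qed simp

definition subtableau_shape :: "nat \<Rightarrow> nat list \<Rightarrow> (nat \<times> nat \<Rightarrow> nat) \<Rightarrow> nat list" where
  "subtableau_shape N lam T = map (\<lambda>i. card {j. j < lam ! i \<and> T (i, j) < N}) [0..<N]"

lemma card_down_closed:
  fixes A :: "nat set"
  assumes "finite A" "\<And>x y. y \<in> A \<Longrightarrow> x \<le> y \<Longrightarrow> x \<in> A"
  shows "A = {..<card A}"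
proof (cases "A = {}")
  case False
  then have "A = {..Max A}" using assms by (auto intro: Max_ge Max_in)
  then obtain k where "A = {..<k}" by (metis lessThan_Suc_atMost)
  then show ?thesis by simp
qed simp

lemma subtableau_shape_iff:
  assumes "T \<in> ssyt (Suc N) lam" "length lam = Suc N" "i < N"
  shows "j < subtableau_shape N lam T ! i \<longleftrightarrow> j < lam ! i \<and> T (i, j) < N"
proof -
  let ?A = "{j. j < lam ! i \<and> T (i, j) < N}"
  have "?A = {..<card ?A}"
  proof (rule card_down_closed)
    fix x y assume "y \<in> ?A" "x \<le> y"
    with ssyt_row_mono[OF assms(1), of i y x] assms show "x \<in> ?A"
      by (auto simp: diagram_def)
  qed auto
  then have "j \<in> ?A \<longleftrightarrow> j < card ?A" by blast
  then show ?thesis using assms by (simp add: subtableau_shape_def)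
qed

text \<open>Deleting the entries equal to \<open>N\<close> from a tableau leaves a tableau of a smaller shape
\<open>nu\<close>.  The deleted cells form a horizontal strip because a column contains \<open>N\<close> at most
once, and every horizontal strip can be refilled with \<open>N\<close> in exactly one way.  The list
\<open>nu\<close> may be taken one row shorter, since the last of the \<open>N + 1\<close> rows is deleted completely.\<close>

theorem schur_branching:
  assumes "sorted_wrt (\<ge>) lam" "length lam = Suc N"
  shows "schur (Suc N) lam
    = (\<Sum>nu | interlaces nu lam. schur N nu * var N ^ (sum_list lam - sum_list nu))"
proof -
  define sh where "sh = subtableau_shape N lam"
  define ext where "ext = (\<lambda>(nu, S) c. if c \<in> diagram nu then S c
      else if c \<in> diagram lam then N else (undefined :: nat))"
  let ?w = "\<lambda>nu S. (\<Prod>c\<in>diagram nu. var (S c)) * var N ^ (sum_list lam - sum_list nu)"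
  have sub: "diagram nu \<subseteq> diagram lam" if "interlaces nu lam" for nu
    using that by (force simp: diagram_def interlaces_def)
  have ext: "ext (nu, S) \<in> ssyt (Suc N) lam" if nu: "interlaces nu lam" and S: "S \<in> ssyt N nu" for nu S
  proof -
    have len: "length nu = N" using nu assms by (simp add: interlaces_def)
    have 1: "ext (nu, S) \<in> diagram lam \<rightarrow>\<^sub>E {..<Suc N}"
      using sub[OF nu] ssyt_less[OF S] by (fastforce simp: ext_def PiE_def extensional_def)
    have 2: "ext (nu, S) (i, j) \<le> ext (nu, S) (i, Suc j)" if "(i, Suc j) \<in> diagram lam" for i j
    proof (cases "(i, Suc j) \<in> diagram nu")
      case True
      then have "(i, j) \<in> diagram nu" by (auto simp: diagram_def)
      with True S show ?thesis by (auto simp: ext_def ssyt_def)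
    next
      case False
      with that have "ext (nu, S) (i, Suc j) = N" by (simp add: ext_def)
      moreover have "(i, j) \<in> diagram lam" using that by (auto simp: diagram_def)
      then have "ext (nu, S) (i, j) < Suc N" using 1 by blast
      ultimately show ?thesis by simp
    qed
    have 3: "ext (nu, S) (i, j) < ext (nu, S) (Suc i, j)" if "(Suc i, j) \<in> diagram lam" for i j
    proof -
      have ij: "(i, j) \<in> diagram nu"
        using that nu len assms by (force simp: diagram_def interlaces_def)
      show ?thesis
      proof (cases "(Suc i, j) \<in> diagram nu")
        case True
        with ij S show ?thesis by (auto simp: ext_def ssyt_def)
      next
        case False
        with that ij ssyt_less[OF S ij] show ?thesis by (simp add: ext_def)
      qed
    qed
    from 1 2 3 show ?thesis by (auto simp: ssyt_def)
  qed
  have shape_ext: "sh (ext (nu, S)) = nu" if nu: "interlaces nu lam" and S: "S \<in> ssyt N nu" for nu S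
  proof (rule nth_equalityI)
    have len: "length nu = N" using nu assms by (simp add: interlaces_def)
    then show "length (sh (ext (nu, S))) = length nu" by (simp add: sh_def subtableau_shape_def)
    fix i assume "i < length (sh (ext (nu, S)))"
    then have i: "i < N" by (simp add: sh_def subtableau_shape_def)
    have "j < lam ! i \<and> ext (nu, S) (i, j) < N \<longleftrightarrow> j < nu ! i" for j
      using i len assms nu ssyt_less[OF S, of "(i, j)"]
      by (force simp: ext_def diagram_def interlaces_def)
    then have "j < sh (ext (nu, S)) ! i \<longleftrightarrow> j < nu ! i" for j
      unfolding sh_def using subtableau_shape_iff[OF ext[OF nu S] assms(2) i] by simp
    then show "sh (ext (nu, S)) ! i = nu ! i"
      by (meson linorder_neqE_nat less_irrefl)
  qed
  have shape: "interlaces (sh T) lam" and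
    restr: "restrict T (diagram (sh T)) \<in> ssyt N (sh T)" and
    top: "\<And>c. c \<in> diagram lam \<Longrightarrow> c \<notin> diagram (sh T) \<Longrightarrow> T c = N"
    if T: "T \<in> ssyt (Suc N) lam" for T
  proof -
    have len: "length (sh T) = N" by (simp add: sh_def subtableau_shape_def)
    have iff: "j < sh T ! i \<longleftrightarrow> j < lam ! i \<and> T (i, j) < N" if "i < N" for i j
      unfolding sh_def by (rule subtableau_shape_iff[OF T assms(2) that])
    show 1: "interlaces (sh T) lam"
      unfolding interlaces_def
    proof (intro conjI allI impI)
      show "length lam = Suc (length (sh T))" using len assms by simp
      fix i assume "i < length (sh T)"
      then have i: "i < N" using len by simp
      show "sh T ! i \<le> lam ! i" using iff[OF i, of "lam ! i"] by auto
      have "j < sh T ! i" if j: "j < lam ! Suc i" for j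
      proof -
        have "(Suc i, j) \<in> diagram lam" using i j assms by (auto simp: diagram_def)
        moreover from this have "T (Suc i, j) < Suc N" by (rule ssyt_less[OF T])
        ultimately have "T (i, j) < N" using T by (fastforce simp: ssyt_def)
        moreover have "j < lam ! i"
          using j i assms(2) sorted_wrt_nth_less[OF assms(1), of i "Suc i"] by simp
        ultimately show ?thesis using iff[OF i] by simp
      qed
      then show "lam ! Suc i \<le> sh T ! i" by (meson not_le less_irrefl)
    qed
    have d: "(i, j) \<in> diagram (sh T) \<longleftrightarrow> i < N \<and> (i, j) \<in> diagram lam \<and> T (i, j) < N" for i j
      using len assms iff[of i j] by (auto simp: diagram_def)
    show "restrict T (diagram (sh T)) \<in> ssyt N (sh T)"
      unfolding ssyt_def
    proof (intro CollectI conjI allI impI)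
      show "restrict T (diagram (sh T)) \<in> diagram (sh T) \<rightarrow>\<^sub>E {..<N}"
        using d by auto
    next
      fix i j assume a: "(i, Suc j) \<in> diagram (sh T)"
      then have "(i, j) \<in> diagram (sh T)" by (auto simp: diagram_def)
      with a show "restrict T (diagram (sh T)) (i, j) \<le> restrict T (diagram (sh T)) (i, Suc j)"
        using T d by (auto simp: ssyt_def)
    next
      fix i j assume a: "(Suc i, j) \<in> diagram (sh T)"
      then have "(Suc i, j) \<in> diagram lam" using d by blast
      then have "(i, j) \<in> diagram lam" "T (i, j) < T (Suc i, j)"
        using T assms(2) sorted_wrt_nth_less[OF assms(1), of i "Suc i"]
        by (auto simp: ssyt_def diagram_def)
      with a d have "(i, j) \<in> diagram (sh T)" by fastforce
      with a \<open>T (i, j) < T (Suc i, j)\<close>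
      show "restrict T (diagram (sh T)) (i, j) < restrict T (diagram (sh T)) (Suc i, j)"
        by simp
    qed
    fix c assume c: "c \<in> diagram lam" "c \<notin> diagram (sh T)"
    obtain i j where ij: "c = (i, j)" by force
    have "T c < Suc N" by (rule ssyt_less[OF T c(1)])
    moreover have "N \<le> T c"
    proof (cases "i < N")
      case True
      with c d ij show ?thesis by auto
    next
      case False
      with row_le_ssyt_entry[OF T assms(1)] c ij show ?thesis by fastforce
    qed
    ultimately show "T c = N" by simp
  qed
  have "schur (Suc N) lam = (\<Sum>(nu, S)\<in>(SIGMA nu:{nu. interlaces nu lam}. ssyt N nu). ?w nu S)"
    unfolding schur_def
  proof (rule sum.reindex_bij_witness[of _ ext "\<lambda>T. (sh T, restrict T (diagram (sh T)))"], goal_cases)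
    case (1 T)
    show ?case
    proof
      fix c
      show "ext (sh T, restrict T (diagram (sh T))) c = T c"
        using 1 top[OF 1, of c] by (auto simp: ext_def ssyt_def)
    qed
  next
    case (2 T)
    then show ?case using shape restr by auto
  next
    case (3 x)
    then obtain nu S where x: "x = (nu, S)" "interlaces nu lam" "S \<in> ssyt N nu" by auto
    have "restrict (ext (nu, S)) (diagram nu) = S"
      using x(3) by (auto simp: ext_def ssyt_def fun_eq_iff)
    then show ?case using shape_ext x by simp
  next
    case (4 x)
    then show ?case using ext by auto
  next
    case (5 T)
    note D = sub[OF shape[OF 5]]
    have "(\<Prod>c\<in>diagram lam. var (T c))
        = (\<Prod>c\<in>diagram lam - diagram (sh T). var (T c)) * (\<Prod>c\<in>diagram (sh T). var (T c))"
      by (rule prod.subset_diff[OF D finite_diagram])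
    also have "(\<Prod>c\<in>diagram lam - diagram (sh T). var (T c)) = (\<Prod>c\<in>diagram lam - diagram (sh T). var N)"
      by (rule prod.cong) (auto simp: top[OF 5])
    also have "\<dots> = var N ^ (sum_list lam - sum_list (sh T))"
      by (simp add: card_Diff_subset[OF finite_diagram D] card_diagram)
    finally show ?case by (simp add: mult.commute)
  qed
  also have "\<dots> = (\<Sum>nu | interlaces nu lam. \<Sum>S\<in>ssyt N nu. ?w nu S)"
    by (rule sum.Sigma[symmetric]) (auto simp: finite_ssyt finite_interlaced)
  finally show ?thesis by (simp add: schur_def sum_distrib_right)
qed

section \<open>Expansion into Schur polynomials\<close>

lemma scal_add: "scal (a + b) = scal a + scal b"
  by (simp add: scal_def single_add)

lemma scal_mult: "scal (a * b) = scal a * scal b"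
  by (simp add: scal_def mult_single)

lemma scal_0 [simp]: "scal 0 = 0" and scal_1 [simp]: "scal 1 = 1"
  by (simp_all add: scal_def)

lemma scal_eq_0_iff [simp]: "scal a = 0 \<longleftrightarrow> a = 0"
  unfolding scal_def by (metis inj_single injD single_zero)

lemma scal_sum: "scal (\<Sum>x\<in>A. f x) = (\<Sum>x\<in>A. scal (f x))"
  by (induction A rule: infinite_finite_induct) (auto simp: scal_add)

text \<open>Partitions into at most \<open>N\<close> parts, padded with zeros to length exactly \<open>N\<close>, so that
they match the lists in \<open>interlaces\<close>.\<close>

definition dec_lists :: "nat \<Rightarrow> nat \<Rightarrow> nat list set" where
  "dec_lists N n = {lam. length lam = N \<and> sorted_wrt (\<ge>) lam \<and> sum_list lam \<le> n}"

lemma finite_dec_lists: "finite (dec_lists N n)"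
proof (rule finite_subset[OF _ finite_lists_length_eq[of "{..n}" N]])
  show "dec_lists N n \<subseteq> {xs. set xs \<subseteq> {..n} \<and> length xs = N}"
    using member_le_sum_list by (fastforce simp: dec_lists_def)
qed simp

lemma interlaces_sorted:
  assumes "interlaces nu lam"
  shows "sorted_wrt (\<ge>) lam"
proof -
  have "lam ! i \<ge> lam ! Suc i" if "Suc i < length lam" for i
    using assms that by (auto simp: interlaces_def intro: le_trans[of _ "nu ! i"])
  then show ?thesis
    by (subst sorted_wrt_iff_nth_Suc_transp) (auto simp: transp_def)
qed

lemma interlaced_sorted:
  assumes "interlaces nu lam"
  shows "sorted_wrt (\<ge>) nu"
proof -
  have "nu ! i \<ge> nu ! Suc i" if "Suc i < length nu" for i
    using assms that by (auto simp: interlaces_def intro: le_trans[of _ "lam ! Suc i"])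
  then show ?thesis
    by (subst sorted_wrt_iff_nth_Suc_transp) (auto simp: transp_def)
qed

lemma schur_no_variables: "schur 0 [] = 1"
proof -
  have "diagram [] = {}" by (simp add: diagram_def)
  then have "ssyt 0 [] = {\<lambda>_. undefined}" by (auto simp: ssyt_def)
  then show ?thesis using \<open>diagram [] = {}\<close> by (simp add: schur_def)
qed

text \<open>Both the existence and the uniqueness of Schur expansions are inductions on the number of
variables, and this is their common step: branching and then collecting by the exponent of
the new variable.\<close>

lemma schur_combination_branching:
  "(\<Sum>lam\<in>dec_lists (Suc N) n. scal (d lam) * schur (Suc N) lam)
     = (\<Sum>k\<le>n. var N ^ k * (\<Sum>nu\<in>dec_lists N n.
         scal (\<Sum>lam | interlaces nu lam \<and> sum_list lam \<le> n \<and> sum_list lam = sum_list nu + k. d lam)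
           * schur N nu))"
proof -
  let ?L = "\<lambda>k nu. {lam. interlaces nu lam \<and> sum_list lam \<le> n \<and> sum_list lam = sum_list nu + k}"
  have "(\<Sum>lam\<in>dec_lists (Suc N) n. scal (d lam) * schur (Suc N) lam)
      = (\<Sum>lam\<in>dec_lists (Suc N) n. \<Sum>nu | interlaces nu lam.
           var N ^ (sum_list lam - sum_list nu) * (scal (d lam) * schur N nu))"
    by (rule sum.cong[OF refl])
      (simp add: dec_lists_def schur_branching sum_distrib_left mult_ac)
  also have "\<dots> = (\<Sum>(lam, nu)\<in>(SIGMA lam:dec_lists (Suc N) n. {nu. interlaces nu lam}).
           var N ^ (sum_list lam - sum_list nu) * (scal (d lam) * schur N nu))"
    by (rule sum.Sigma) (auto simp: finite_dec_lists finite_interlaced)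
  also have "\<dots> = (\<Sum>(p, lam)\<in>(SIGMA p:{..n} \<times> dec_lists N n. ?L (fst p) (snd p)).
           var N ^ fst p * (scal (d lam) * schur N (snd p)))"
    by (rule sum.reindex_bij_witness[of _ "\<lambda>(p, lam). (lam, snd p)"
          "\<lambda>(lam, nu). ((sum_list lam - sum_list nu, nu), lam)"])
      (auto simp: dec_lists_def interlaced_sorted interlaces_sorted interlaces_length
        dest: interlaces_sum_le)
  also have "\<dots> = (\<Sum>p\<in>{..n} \<times> dec_lists N n. \<Sum>lam\<in>?L (fst p) (snd p).
           var N ^ fst p * (scal (d lam) * schur N (snd p)))"
    by (rule sum.Sigma[symmetric])
      (use finite_interlaces[of _ "\<lambda>lam. sum_list lam \<le> n"] in \<open>auto simp: finite_dec_lists\<close>)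
  also have "\<dots> = (\<Sum>k\<le>n. \<Sum>nu\<in>dec_lists N n. \<Sum>lam\<in>?L k nu.
           var N ^ k * (scal (d lam) * schur N nu))"
    by (simp add: sum.cartesian_product split_beta)
  also have "\<dots> = (\<Sum>k\<le>n. var N ^ k * (\<Sum>nu\<in>dec_lists N n. scal (\<Sum>lam\<in>?L k nu. d lam) * schur N nu))"
    by (simp add: scal_sum sum_distrib_left sum_distrib_right)
  finally show ?thesis .
qed

text \<open>The polynomial in \<open>N\<close> variables with monomial coefficients \<open>f\<close>, up to exponent \<open>n\<close>.  The first exponent
belongs to the variable with the largest index; for symmetric \<open>f\<close> the order is immaterial.\<close>

fun monomial_sum :: "nat \<Rightarrow> nat \<Rightarrow> (int list \<Rightarrow> cq) \<Rightarrow> mpoly_cq" where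
  "monomial_sum n 0 f = scal (f [])"
| "monomial_sum n (Suc N) f = (\<Sum>k\<le>n. var N ^ k * monomial_sum n N (\<lambda>ga. f (int k # ga)))"

lemma monomial_sum_sum:
  "monomial_sum n N (\<lambda>ga. \<Sum>t\<in>A. w t * F t ga) = (\<Sum>t\<in>A. scal (w t) * monomial_sum n N (F t))"
proof (induction N arbitrary: F)
  case (Suc N)
  show ?case
    unfolding monomial_sum.simps Suc.IH sum_distrib_left
    by (subst sum.swap) (simp add: mult_ac)
qed (simp add: scal_sum scal_mult)

text \<open>By induction on the number of variables, \<open>schur_coeff\<close> gives the coefficients of the Schur expansion: the
inner sums that arise from branching are evaluated by the Pieri rule.\<close>

theorem schur_expansion:
  assumes "symmetric_coeffs f" "\<And>al. int n < sum_list al \<Longrightarrow> f al = 0"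
  shows "(\<Sum>lam\<in>dec_lists N n. scal (schur_coeff f (map int lam)) * schur N lam) = monomial_sum n N f"
  using assms
proof (induction N arbitrary: f)
  case 0
  have "dec_lists 0 n = {[]}" by (auto simp: dec_lists_def)
  then show ?case by (simp add: schur_no_variables)
next
  case (Suc N)
  have coeff: "(\<Sum>lam | interlaces nu lam \<and> sum_list lam \<le> n \<and> sum_list lam = sum_list nu + k.
      schur_coeff f (map int lam)) = schur_coeff (\<lambda>ga. f (int k # ga)) (map int nu)"
    if "nu \<in> dec_lists N n" for nu k
  proof -
    have 0: "schur_coeff f (map int lam) = 0" if "n < sum_list lam" for lam
    proof -
      have "sum_list (map int lam) = int (sum_list lam)" by (induction lam) auto
      with that have "schur_coeff f (map int lam) = schur_coeff (\<lambda>ga. 0) (map int lam)"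
        by (intro schur_coeff_cong_sum Suc.prems(2)) simp
      then show ?thesis by (simp add: schur_coeff_zero)
    qed
    have "(\<Sum>lam | interlaces nu lam \<and> sum_list lam \<le> n \<and> sum_list lam = sum_list nu + k.
        schur_coeff f (map int lam))
      = (\<Sum>lam | interlaces nu lam \<and> sum_list lam = sum_list nu + k. schur_coeff f (map int lam))"
      using finite_interlaces[of nu "\<lambda>_. True" "sum_list nu + k"]
      by (intro sum.mono_neutral_left) (auto intro!: 0)
    also have "\<dots> = schur_coeff (\<lambda>ga. f (int k # ga)) (map int nu)"
      using that by (intro schur_coeff_pieri[symmetric] Suc.prems) (simp add: dec_lists_def)
    finally show ?thesis .
  qed
  have IH: "(\<Sum>nu\<in>dec_lists N n. scal (schur_coeff (\<lambda>ga. f (int k # ga)) (map int nu)) * schur N nu)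
      = monomial_sum n N (\<lambda>ga. f (int k # ga))" for k
    by (rule Suc.IH[OF symmetric_coeffs_Cons[OF Suc.prems(1)]]) (auto intro: Suc.prems(2))
  show ?case
    unfolding schur_combination_branching monomial_sum.simps IH[symmetric]
    by (simp add: coeff)
qed

definition vars_below :: "nat \<Rightarrow> mpoly_cq \<Rightarrow> bool" where
  "vars_below N p \<longleftrightarrow> (\<forall>m\<in>Poly_Mapping.keys p. \<forall>i\<ge>N. Poly_Mapping.lookup m i = 0)"

lemma vars_below_scal: "vars_below N (scal c)"
  by (simp add: vars_below_def scal_def)

lemma vars_below_var: "i < N \<Longrightarrow> vars_below N (var i)"
  by (auto simp: vars_below_def var_def lookup_single)

lemma vars_below_add: "vars_below N p \<Longrightarrow> vars_below N q \<Longrightarrow> vars_below N (p + q)"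
  using Poly_Mapping.keys_add[of p q] by (fastforce simp: vars_below_def)

lemma vars_below_mult: "vars_below N p \<Longrightarrow> vars_below N q \<Longrightarrow> vars_below N (p * q)"
  using keys_mult[of p q] by (fastforce simp: vars_below_def lookup_add)

lemma vars_below_sum: "(\<And>x. x \<in> A \<Longrightarrow> vars_below N (f x)) \<Longrightarrow> vars_below N (sum f A)"
  by (induction A rule: infinite_finite_induct)
    (auto intro: vars_below_add simp: vars_below_scal[of N 0, simplified])

lemma vars_below_prod: "(\<And>x. x \<in> A \<Longrightarrow> vars_below N (f x)) \<Longrightarrow> vars_below N (prod f A)"
  by (induction A rule: infinite_finite_induct)
    (auto intro: vars_below_mult simp: vars_below_scal[of N 1, simplified])

lemma vars_below_schur: "vars_below N (schur N lam)"
  unfolding schur_def by (intro vars_below_sum vars_below_prod vars_below_var ssyt_less)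

lemma var_power: "var N ^ k = Poly_Mapping.single (Poly_Mapping.single N k) 1"
  by (induction k) (simp_all add: var_def mult_single flip: single_add)

lemma lookup_monomial_mult:
  "Poly_Mapping.lookup (Poly_Mapping.single a 1 * p) (a + m) = Poly_Mapping.lookup p m" for p :: mpoly_cq
  by (simp add: lookup_mult lookup_single when_mult)

lemma var_power_combination_zero:
  assumes "(\<Sum>k\<le>n. var N ^ k * A k) = 0" "\<And>k. vars_below N (A k)" "k \<le> n"
  shows "A k = 0"
proof -
  have "Poly_Mapping.lookup (A k) m = 0" for m
  proof (cases "m \<in> Poly_Mapping.keys (A k)")
    case True
    with assms(2) have mN: "Poly_Mapping.lookup m N = 0" by (auto simp: vars_below_def)
    let ?x = "\<lambda>j. Poly_Mapping.single N j"
    have "Poly_Mapping.lookup (var N ^ j * A j) (?x k + m) = 0" if "j \<noteq> k" for j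
    proof (rule ccontr)
      assume "Poly_Mapping.lookup (var N ^ j * A j) (?x k + m) \<noteq> 0"
      then have "?x k + m \<in> Poly_Mapping.keys (var N ^ j * A j)" by (simp add: in_keys_iff)
      then obtain a b where "?x k + m = a + b" "a \<in> Poly_Mapping.keys (var N ^ j)" "b \<in> Poly_Mapping.keys (A j)"
        using keys_mult[of "var N ^ j" "A j"] by auto
      then have "?x k + m = ?x j + b" and b: "Poly_Mapping.lookup b N = 0"
        using assms(2)[of j] by (auto simp: var_power vars_below_def)
      from arg_cong[OF this(1), of "\<lambda>x. Poly_Mapping.lookup x N"] mN b \<open>j \<noteq> k\<close> show False
        by (simp add: lookup_add)
    qed
    then have "Poly_Mapping.lookup (\<Sum>j\<le>n. var N ^ j * A j) (?x k + m)
        = Poly_Mapping.lookup (var N ^ k * A k) (?x k + m)"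
      using assms(3) by (simp add: lookup_sum lookup_add sum.remove[of _ k])
    also have "\<dots> = Poly_Mapping.lookup (A k) m"
      by (simp add: var_power lookup_monomial_mult)
    finally show ?thesis by (simp add: assms(1))
  qed (simp add: in_keys_iff)
  then show ?thesis by (intro poly_mapping_eqI) simp
qed

text \<open>A vanishing combination gives, after branching, vanishing sums of \<open>d\<close> over all \<open>mu\<close> of a
fixed size that interlace with a given \<open>nu\<close>.  Take for \<open>nu\<close> the rows of \<open>lam\<close> below the
first: every other \<open>mu\<close> in the sum has a longer first row than \<open>lam\<close>, so descending
induction on the first row isolates \<open>d lam\<close>.\<close>

theorem schur_linearly_independent:
  assumes "(\<Sum>lam\<in>dec_lists N n. scal (d lam) * schur N lam) = 0" "lam \<in> dec_lists N n"
  shows "d lam = 0"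
  using assms
proof (induction N arbitrary: d lam)
  case 0
  have "dec_lists 0 n = {[]}" by (auto simp: dec_lists_def)
  with 0 show ?case by (simp add: schur_no_variables)
next
  case (Suc N)
  define D where "D = (\<lambda>k nu. \<Sum>lam | interlaces nu lam \<and> sum_list lam \<le> n \<and> sum_list lam = sum_list nu + k. d lam)"
  have "(\<Sum>k\<le>n. var N ^ k * (\<Sum>nu\<in>dec_lists N n. scal (D k nu) * schur N nu)) = 0"
    using Suc.prems(1) unfolding schur_combination_branching D_def .
  then have "(\<Sum>nu\<in>dec_lists N n. scal (D k nu) * schur N nu) = 0" if "k \<le> n" for k
    by (rule var_power_combination_zero)
      (intro vars_below_sum vars_below_mult vars_below_scal vars_below_schur that)+
  then have D: "D k nu = 0" if "k \<le> n" "nu \<in> dec_lists N n" for k nu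
    using that Suc.IH[of "D k"] by blast
  \<comment> \<open>descending induction on the first row, which is at most \<open>n\<close>\<close>
  show ?case using Suc.prems(2)
  proof (induction "n - hd lam" arbitrary: lam rule: less_induct)
    case less
    obtain a nu where lam: "lam = a # nu"
      using less.prems by (cases lam) (auto simp: dec_lists_def)
    have nu: "nu \<in> dec_lists N n" "a \<le> n" and len: "length nu = N"
      using less.prems by (auto simp: lam dec_lists_def)
    have il: "interlaces nu lam"
      using less.prems sorted_wrt_nth_less[of "(\<ge>)" lam _ "Suc _"]
      by (auto simp: interlaces_def lam dec_lists_def)
    let ?L = "{mu. interlaces nu mu \<and> sum_list mu \<le> n \<and> sum_list mu = sum_list nu + a}"
    have "d mu = 0" if mu: "mu \<in> ?L" "mu \<noteq> lam" for mu
    proof -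
      obtain b ka where m: "mu = b # ka" using mu by (cases mu) (auto simp: interlaces_def)
      have *: "length ka = length nu" "\<forall>i<length nu. ka ! i \<le> nu ! i"
        using mu by (auto simp: m interlaces_def)
      have "a < b"
      proof (rule ccontr)
        assume "\<not> a < b"
        with mu have le: "sum_list nu \<le> sum_list ka" by (auto simp: m)
        have "ka = nu"
        proof (rule nth_equalityI[OF *(1)])
          fix i assume i: "i < length ka"
          show "ka ! i = nu ! i"
          proof (rule ccontr)
            assume "ka ! i \<noteq> nu ! i"
            with i * have "(\<Sum>i<length nu. ka ! i) < (\<Sum>i<length nu. nu ! i)"
              by (intro sum_strict_mono_ex1) (auto intro!: bexI[of _ i] le_neq_trans)
            with le * show False by (simp add: sum_list_sum_nth atLeast0LessThan)
          qed
        qed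
        with mu show False by (auto simp: m lam)
      qed
      moreover have "mu \<in> dec_lists (Suc N) n"
        using mu len by (auto simp: dec_lists_def interlaces_sorted interlaces_length)
      moreover have "b \<le> n" using mu by (auto simp: m)
      ultimately show ?thesis using less.hyps[of mu] by (simp add: m lam)
    qed
    then have "D a nu = (\<Sum>mu\<in>{lam}. d mu)"
      unfolding D_def
      by (intro sum.mono_neutral_right)
        (use il less.prems finite_interlaces[of nu "\<lambda>l. sum_list l \<le> n" "sum_list nu + a"]
          in \<open>auto simp: lam dec_lists_def\<close>)
    with D[OF nu(2) nu(1)] show ?case by simp
  qed
qed

section \<open>Adjoining a variable to the deformed power sum series\<close>

lemma fps_linear_ode_unique:
  fixes X Y B :: "'a::{idom, ring_char_0} fps"
  assumes "fps_deriv X = B * X" "fps_deriv Y = B * Y" "fps_nth X 0 = fps_nth Y 0"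
  shows "X = Y"
proof -
  define Z where "Z = X - Y"
  have Z: "fps_deriv Z = B * Z" "fps_nth Z 0 = 0"
    using assms by (simp_all add: Z_def algebra_simps)
  have "fps_nth Z n = 0" for n
  proof (induction n rule: less_induct)
    case (less n)
    show ?case
    proof (cases n)
      case (Suc k)
      have "of_nat (Suc k) * fps_nth Z (Suc k) = fps_nth (B * Z) k"
        unfolding Z(1)[symmetric] by simp
      also have "\<dots> = 0"
        unfolding fps_mult_nth using less Suc by (intro sum.neutral) auto
      finally show ?thesis using Suc by (metis mult_eq_0_iff of_nat_neq_0)
    qed (simp add: Z)
  qed
  then have "Z = 0" by (simp add: fps_eq_iff)
  then show ?thesis by (simp add: Z_def)
qed

lemma scal_of_nat: "scal (of_nat n) = of_nat n"
  by (simp add: scal_def)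

lemma exp_series_deriv:
  assumes "fps_nth F 0 = 0"
  shows "fps_deriv (exp_series F) = fps_deriv F * exp_series F"
proof -
  let ?E = "Abs_fps (\<lambda>k. scal (1 / of_nat (fact k)))"
  have "fps_deriv ?E = ?E"
  proof (rule fps_ext)
    fix k
    have "(of_nat (Suc k) :: mpoly_cq) * scal (1 / of_nat (fact (Suc k)))
        = scal (of_nat (Suc k) * (1 / of_nat (fact (Suc k))))"
      by (simp only: scal_mult scal_of_nat)
    also have "of_nat (Suc k) * (1 / of_nat (fact (Suc k))) = (1 / of_nat (fact k) :: cq)"
    proof -
      have "(of_nat (fact (Suc k)) :: cq) = of_nat (Suc k) * of_nat (fact k)"
        by (simp only: fact_Suc of_nat_mult of_nat_id)
      then show ?thesis
        using of_nat_neq_0[of k, where 'a = cq] by (simp del: of_nat_Suc of_nat_fact fact_Suc)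
    qed
    finally show "fps_nth (fps_deriv ?E) k = fps_nth ?E k"
      by (simp del: of_nat_Suc of_nat_fact fact_Suc)
  qed
  with fps_compose_deriv[OF assms, of ?E] show ?thesis by (simp add: exp_series_def mult.commute)
qed

lemma exp_series_nth_0: "fps_nth (exp_series F) 0 = 1"
  by (simp add: exp_series_def)

lemma fps_nth_mult_one_minus:
  "fps_nth (F * (1 - fps_const a * fps_X)) n = fps_nth F n - (if n = 0 then 0 else a * fps_nth F (n - 1))"
  for a :: "'a::comm_ring_1"
proof -
  have "F * (1 - fps_const a * fps_X) = F - fps_const a * (fps_X * F)"
    by (simp only: right_diff_distrib mult_1_right mult_ac)
  then show ?thesis by simp
qed

text \<open>The expansion of \<open>(1 - t x z) / (1 - x z)\<close> in powers of \<open>z\<close>.\<close>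

definition one_variable_series :: "cq \<Rightarrow> mpoly_cq \<Rightarrow> mpoly_cq fps" where
  "one_variable_series t x = Abs_fps (\<lambda>k. if k = 0 then 1 else scal (1 - t) * x ^ k)"

text \<open>The added exponent is \<open>log ((1 - t x z) / (1 - x z))\<close>.  Instead of introducing logarithms,
both sides are seen to solve the same first order linear differential equation with initial
value 1; the logarithmic derivative of the quotient is checked after clearing the denominators
\<open>u = 1 - x z\<close> and \<open>v = 1 - t x z\<close>.\<close>

lemma exp_series_add_variable:
  assumes "fps_nth F 0 = 0"
  shows "exp_series (F + Abs_fps (\<lambda>k. if k = 0 then 0 else scal ((1 - t ^ k) / of_nat k) * x ^ k))
    = exp_series F * one_variable_series t x"
proof (rule fps_linear_ode_unique)
  let ?B = "Abs_fps (\<lambda>k. if k = 0 then 0 else scal ((1 - t ^ k) / of_nat k) * x ^ k)"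
  let ?Y = "one_variable_series t x"
  let ?u = "1 - fps_const x * fps_X :: mpoly_cq fps"
  let ?v = "1 - fps_const (scal t * x) * fps_X :: mpoly_cq fps"
  have scal_power: "scal (t ^ k) = scal t ^ k" for k by (induction k) (auto simp: scal_mult)
  have scal_diff: "scal (a - b) = scal a - scal b" for a b
    by (simp add: scal_def single_diff)
  have dB: "fps_deriv ?B = Abs_fps (\<lambda>k. (1 - scal t ^ Suc k) * x ^ Suc k)"
  proof (rule fps_ext)
    fix k
    have "(of_nat (Suc k) :: mpoly_cq) * scal ((1 - t ^ Suc k) / of_nat (Suc k))
        = scal (of_nat (Suc k) * ((1 - t ^ Suc k) / of_nat (Suc k)))"
      by (simp only: scal_mult scal_of_nat)
    also have "of_nat (Suc k) * ((1 - t ^ Suc k) / of_nat (Suc k)) = (1 - t ^ Suc k :: cq)"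
      using of_nat_neq_0[of k, where 'a = cq] by (simp del: of_nat_Suc)
    finally have "(of_nat (Suc k) :: mpoly_cq) * scal ((1 - t ^ Suc k) / of_nat (Suc k))
        = 1 - scal t ^ Suc k"
      by (simp only: scal_diff scal_power scal_1)
    then show "fps_nth (fps_deriv ?B) k = fps_nth (Abs_fps (\<lambda>k. (1 - scal t ^ Suc k) * x ^ Suc k)) k"
      by (simp add: mult.assoc[symmetric] del: of_nat_Suc power_Suc)
  qed
  have Y: "?Y * ?u = ?v"
  proof (rule fps_ext)
    fix n
    have "fps_nth (?Y * ?u) n = fps_nth ?Y n - (if n = 0 then 0 else x * fps_nth ?Y (n - 1))"
      by (rule fps_nth_mult_one_minus)
    also have "\<dots> = fps_nth ?v n"
      using fps_nth_mult_one_minus[of 1 "scal t * x" n]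
      by (cases n) (auto simp: one_variable_series_def scal_diff algebra_simps)
    finally show "fps_nth (?Y * ?u) n = fps_nth ?v n" .
  qed
  have "fps_nth ?u 0 \<noteq> 0" by simp
  then have u: "?u \<noteq> 0" by force
  have cross: "a * (1 - b * fps_X) - b * (1 - a * fps_X) = a - b" for a b :: "mpoly_cq fps"
    by (simp add: algebra_simps)
  have B: "fps_deriv ?B * ?u * ?v = fps_const x - fps_const (scal t * x)"
  proof -
    let ?g = "\<lambda>y :: mpoly_cq. Abs_fps (\<lambda>k. y ^ k)"
    have dec: "(a * p - b * q) * u * v = a * (p * u) * v - b * (q * v) * u"
      for a b p q u v :: "mpoly_cq fps"
      by (simp add: algebra_simps)
    have g: "?g y * (1 - fps_const y * fps_X) = 1" for y
    proof (rule fps_ext)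
      show "fps_nth (?g y * (1 - fps_const y * fps_X)) n = fps_nth 1 n" for n
        unfolding fps_nth_mult_one_minus by (cases n) simp_all
    qed
    have "fps_deriv ?B = fps_const x * ?g x - fps_const (scal t * x) * ?g (scal t * x)"
      unfolding dB by (rule fps_ext) (simp add: algebra_simps power_mult_distrib)
    then show ?thesis
      by (simp only: dec g mult_1_right cross)
  qed
  have dY: "fps_deriv ?Y * ?u * ?u = fps_const x - fps_const (scal t * x)"
  proof -
    have "fps_deriv ?Y * ?u = ?Y * fps_const x - fps_const (scal t * x)"
      using arg_cong[OF Y, of fps_deriv] by (simp add: algebra_simps flip: fps_const_neg)
    then have "fps_deriv ?Y * ?u * ?u = (?Y * fps_const x - fps_const (scal t * x)) * ?u"
      by (rule arg_cong)
    also have "\<dots> = fps_const x * (?Y * ?u) - fps_const (scal t * x) * ?u"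
      by (simp only: left_diff_distrib mult.assoc mult.left_commute[of _ "fps_const x"])
    also have "\<dots> = fps_const x - fps_const (scal t * x)"
      unfolding Y by (rule cross)
    finally show ?thesis .
  qed
  have "(fps_deriv ?B * ?Y) * (?u * ?u) = fps_deriv ?B * ?u * (?Y * ?u)"
    by (simp only: mult_ac)
  also have "\<dots> = fps_deriv ?Y * (?u * ?u)"
    unfolding Y B dY[symmetric] by (simp only: mult.assoc)
  finally have Y': "fps_deriv ?Y = fps_deriv ?B * ?Y"
    using u by simp
  show "fps_deriv (exp_series F * ?Y) = fps_deriv (F + ?B) * (exp_series F * ?Y)"
    by (simp only: fps_deriv_mult exp_series_deriv[OF assms] Y' fps_deriv_add) (simp only: algebra_simps)
  show "fps_deriv (exp_series (F + ?B)) = fps_deriv (F + ?B) * exp_series (F + ?B)"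
    by (rule exp_series_deriv) (simp add: assms)
  show "fps_nth (exp_series (F + ?B)) 0 = fps_nth (exp_series F * ?Y) 0"
    by (simp add: exp_series_nth_0 one_variable_series_def)
qed

text \<open>The coefficient of \<open>x\<^sup>k z\<^sup>k\<close> in \<open>(1 - t x z) / (1 - x z)\<close>.\<close>

definition removal_weight :: "cq \<Rightarrow> nat \<Rightarrow> cq" where
  "removal_weight t k = (if k = 0 then 1 else 1 - t)"

lemma q_hat_Suc: "q_hat (Suc N) t n = (\<Sum>k\<le>n. scal (removal_weight t k) * var N ^ k * q_hat N t (n - k))"
proof -
  let ?F = "\<lambda>N. Abs_fps (\<lambda>k. if k = 0 then 0 else scal ((1 - t ^ k) / of_nat k) * p_hat N k)"
  have "?F (Suc N) = ?F N + Abs_fps (\<lambda>k. if k = 0 then 0 else scal ((1 - t ^ k) / of_nat k) * var N ^ k)"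
    by (rule fps_ext) (simp add: p_hat_def power_sum_def algebra_simps)
  then have "q_hat (Suc N) t n = fps_nth (exp_series (?F N) * one_variable_series t (var N)) n"
    unfolding q_hat_def by (subst exp_series_add_variable[symmetric]) simp_all
  also have "\<dots> = (\<Sum>k\<le>n. scal (removal_weight t k) * var N ^ k * q_hat N t (n - k))"
    unfolding mult.commute[of "exp_series _"] fps_mult_nth atMost_atLeast0
    by (intro sum.cong refl) (auto simp: q_hat_def one_variable_series_def removal_weight_def)
  finally show ?thesis .
qed

text \<open>The summand 1 in \<open>p_hat\<close> behaves like one additional variable with value 1.\<close>

lemma q_hat_no_variables: "q_hat 0 t n = scal (removal_weight t n)"
proof -
  have "(Abs_fps (\<lambda>k. if k = 0 then 0 else scal ((1 - t ^ k) / of_nat k) * p_hat 0 k) :: mpoly_cq fps)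
      = 0 + Abs_fps (\<lambda>k. if k = 0 then 0 else scal ((1 - t ^ k) / of_nat k) * 1 ^ k)"
    by (rule fps_ext) (simp add: p_hat_def power_sum_def)
  moreover have "exp_series 0 = 1"
    by (rule fps_linear_ode_unique[of _ 0]) (simp_all add: exp_series_deriv exp_series_nth_0)
  ultimately have "q_hat 0 t n = fps_nth (one_variable_series t 1) n"
    unfolding q_hat_def by (simp only: exp_series_add_variable[of 0 t 1] fps_zero_nth) simp
  then show ?thesis by (simp add: one_variable_series_def removal_weight_def)
qed

section \<open>Schur coefficients of the Frobenius series\<close>

definition composition_weight :: "cq \<Rightarrow> nat list \<Rightarrow> cq" where
  "composition_weight t tau = prod_list (map (removal_weight t) tau)"

lemma composition_weight_power: "composition_weight t tau = (1 - t) ^ nz_len tau"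
  by (induction tau) (auto simp: composition_weight_def removal_weight_def nz_len_def)

text \<open>The monomial coefficients of \<open>q_hat_part N t mu\<close>, for all numbers \<open>N\<close> of variables at once.
The second equation says
\<open>h\<^sub>a\<^sup>\<bottom> q\<^sub>\<mu> = \<Sum>\<^sub>\<tau> (1 - t)\<^bsup>l(\<tau>)\<^esup> q\<^bsub>\<mu>-\<tau>\<^esub>\<close>; it is where the sum over
compositions in the final recurrence comes from.\<close>

fun q_hat_coeff :: "cq \<Rightarrow> nat list \<Rightarrow> int list \<Rightarrow> cq" where
  "q_hat_coeff t mu [] = composition_weight t mu"
| "q_hat_coeff t mu (a # al) = (if a < 0 then 0 else
     \<Sum>tau\<in>sub_compositions mu (nat a). composition_weight t tau * q_hat_coeff t (comp_diff mu tau) al)"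

lemma sub_diagram_Cons: "sub_diagram (a # xs) (b # ys) \<longleftrightarrow> a \<le> b \<and> sub_diagram xs ys"
proof -
  have "(\<forall>i. P i) \<longleftrightarrow> P 0 \<and> (\<forall>i. P (Suc i))" for P :: "nat \<Rightarrow> bool"
    by (metis not0_implies_Suc)
  from this[of "\<lambda>i. nth_default 0 (a # xs) i \<le> nth_default 0 (b # ys) i"]
  show ?thesis by (simp add: sub_diagram_def)
qed

lemma sub_diagram_list_all2:
  assumes "length tau = length mu"
  shows "sub_diagram tau mu \<longleftrightarrow> list_all2 (\<le>) tau mu"
  using assms
proof (induction tau mu rule: list_induct2)
  case Nil
  show ?case by (simp add: sub_diagram_def)
qed (simp add: sub_diagram_Cons)

lemma sub_compositions_iff:
  "tau \<in> sub_compositions mu k \<longleftrightarrow> list_all2 (\<le>) tau mu \<and> sum_list tau = k"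
  using sub_diagram_list_all2[of tau mu] list_all2_lengthD[of "(\<le>)" tau mu]
  by (auto simp: sub_compositions_def)

lemma finite_list_all2_le: "finite {tau. list_all2 (\<le>) tau (mu :: nat list)}"
proof (induction mu)
  case (Cons m mu)
  have "{tau. list_all2 (\<le>) tau (m # mu)} = (\<lambda>(k, tau). k # tau) ` ({..m} \<times> {tau. list_all2 (\<le>) tau mu})"
    by (auto simp: list_all2_Cons2)
  then show ?case using Cons by simp
qed simp

lemma finite_sub_compositions: "finite (sub_compositions mu k)"
  by (rule finite_subset[OF _ finite_list_all2_le[of mu]]) (auto simp: sub_compositions_iff)

lemma sum_list_comp_diff:
  "list_all2 (\<le>) tau mu \<Longrightarrow> sum_list (comp_diff mu tau) + sum_list tau = sum_list mu"
  by (induction rule: list_all2_induct) (auto simp: comp_diff_def)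

lemma comp_diff_commute: "comp_diff (comp_diff mu tau) sig = comp_diff (comp_diff mu sig) tau"
  if "length tau = length mu" "length sig = length mu"
  using that unfolding comp_diff_def by (intro nth_equalityI) auto

lemma list_all2_le_comp_diff:
  fixes mu :: "nat list"
  assumes "list_all2 (\<le>) tau mu" "list_all2 (\<le>) sig (comp_diff mu tau)"
  shows "list_all2 (\<le>) sig mu \<and> list_all2 (\<le>) tau (comp_diff mu sig)"
  using assms
  by (induction arbitrary: sig rule: list_all2_induct) (auto simp: comp_diff_def list_all2_Cons2)

text \<open>Removing \<open>\<tau>\<close> and then \<open>\<sigma>\<close> from \<open>\<mu>\<close> gives the same as removing them in the opposite order.\<close>

lemma q_hat_coeff_swap: "q_hat_coeff t mu (a # b # al) = q_hat_coeff t mu (b # a # al)"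
proof (cases "a < 0 \<or> b < 0")
  case False
  let ?S = "\<lambda>a b. SIGMA tau:sub_compositions mu (nat a). sub_compositions (comp_diff mu tau) (nat b)"
  let ?h = "\<lambda>tau sig. composition_weight t tau * (composition_weight t sig * q_hat_coeff t (comp_diff (comp_diff mu tau) sig) al)"
  have *: "q_hat_coeff t mu (a # b # al) = (\<Sum>(tau, sig)\<in>?S a b. ?h tau sig)"
    if "\<not> (a < 0 \<or> b < 0)" for a b
    using that by (simp add: sum_distrib_left sum.Sigma finite_sub_compositions)
  have swap: "(sig, tau) \<in> ?S b a" if "(tau, sig) \<in> ?S a b" for tau sig a b
    using that list_all2_le_comp_diff[of tau mu sig] by (auto simp: sub_compositions_iff)
  have "(\<Sum>(tau, sig)\<in>?S a b. ?h tau sig) = (\<Sum>(tau, sig)\<in>?S b a. ?h tau sig)"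
  proof (rule sum.reindex_bij_witness[of _ prod.swap prod.swap], goal_cases)
    case (5 x)
    then obtain tau sig where x: "x = (tau, sig)" "(tau, sig) \<in> ?S a b" by (cases x) auto
    then have "list_all2 (\<le>) tau mu" "list_all2 (\<le>) sig mu"
      using swap[OF x(2)] by (auto simp: sub_compositions_iff)
    then have "comp_diff (comp_diff mu tau) sig = comp_diff (comp_diff mu sig) tau"
      by (intro comp_diff_commute list_all2_lengthD)
    then show ?case
      by (simp only: x(1) prod.swap_def fst_conv snd_conv prod.case mult.left_commute)
  next
    case (2 x)
    then show ?case using swap[of "fst x" "snd x" a b] by (simp only: prod.swap_def prod.collapse)
  next
    case (4 x)
    then show ?case using swap[of "fst x" "snd x" b a] by (simp only: prod.swap_def prod.collapse)
  qed simp_all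
  moreover have "\<not> (b < 0 \<or> a < 0)" using False by blast
  ultimately show ?thesis unfolding *[OF False] *[OF \<open>\<not> (b < 0 \<or> a < 0)\<close>] by simp
qed auto

lemma symmetric_q_hat_coeff: "symmetric_coeffs (q_hat_coeff t mu)"
  unfolding symmetric_coeffs_def
proof (intro conjI allI impI)
  show "q_hat_coeff t mu (p @ a # b # s) = q_hat_coeff t mu (p @ b # a # s)" for p a b s
    by (induction p arbitrary: mu) (simp_all add: q_hat_coeff_swap del: q_hat_coeff.simps(2), simp)
  show "q_hat_coeff t mu (p @ [x]) = 0" if "x < 0" for p x
    using that by (induction p arbitrary: mu) auto
qed

lemma q_hat_coeff_degree: "int (sum_list mu) < sum_list al \<Longrightarrow> q_hat_coeff t mu al = 0"
proof (induction al arbitrary: mu)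
  case (Cons a al)
  have "q_hat_coeff t (comp_diff mu tau) al = 0" if "tau \<in> sub_compositions mu (nat a)" "a \<ge> 0" for tau
    using that Cons.prems sum_list_comp_diff[of tau mu]
    by (intro Cons.IH) (auto simp: sub_compositions_iff)
  then show ?case by auto
qed simp

lemma sub_compositions_0: "sub_compositions mu 0 = {replicate (length mu) 0}"
proof (intro set_eqI iffI)
  fix tau assume "tau \<in> sub_compositions mu 0"
  then have "list_all2 (\<le>) tau mu" "\<forall>x\<in>set tau. x = 0" by (auto simp: sub_compositions_iff)
  then show "tau \<in> {replicate (length mu) 0}"
    by (auto intro!: replicate_eqI dest: list_all2_lengthD)
qed (auto simp: sub_compositions_iff list_all2_conv_all_nth sum_list_replicate)

lemma q_hat_coeff_append_zero: "q_hat_coeff t mu (al @ [0]) = q_hat_coeff t mu al"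
proof (induction al arbitrary: mu)
  case Nil
  have "comp_diff mu (replicate (length mu) 0) = mu"
    unfolding comp_diff_def by (induction mu) auto
  then show ?case by (simp add: sub_compositions_0 composition_weight_power nz_len_def)
qed auto

text \<open>Each factor of the product chooses its exponent of the new variable by \<open>q_hat_Suc\<close>; the
choices form \<open>tau\<close>.\<close>

lemma q_hat_part_Suc:
  assumes "sum_list mu \<le> n"
  shows "q_hat_part (Suc N) t mu = (\<Sum>k\<le>n. var N ^ k *
    (\<Sum>tau\<in>sub_compositions mu k. scal (composition_weight t tau) * q_hat_part N t (comp_diff mu tau)))"
proof -
  let ?B = "\<lambda>mu :: nat list. {tau. list_all2 (\<le>) tau mu}"
  let ?h = "\<lambda>mu tau. scal (composition_weight t tau) * var N ^ sum_list tau * q_hat_part N t (comp_diff mu tau)"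
  have "q_hat_part (Suc N) t mu = (\<Sum>tau\<in>?B mu. ?h mu tau)"
  proof (induction mu)
    case Nil
    then show ?case by (simp add: q_hat_part_def composition_weight_def comp_diff_def)
  next
    case (Cons m mu)
    have "q_hat_part (Suc N) t (m # mu) = q_hat (Suc N) t m * q_hat_part (Suc N) t mu"
      by (simp add: q_hat_part_def)
    also have "\<dots> = (\<Sum>k\<le>m. \<Sum>tau\<in>?B mu. ?h (m # mu) (k # tau))"
      unfolding Cons q_hat_Suc sum_product
      by (intro sum.cong refl)
        (simp add: composition_weight_def scal_mult power_add q_hat_part_def comp_diff_def mult_ac)
    also have "\<dots> = (\<Sum>(k, tau)\<in>{..m} \<times> ?B mu. ?h (m # mu) (k # tau))"
      by (rule sum.cartesian_product)
    also have "\<dots> = (\<Sum>tau\<in>?B (m # mu). ?h (m # mu) tau)"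
      by (rule sum.reindex_bij_witness[of _ "\<lambda>tau. (hd tau, tl tau)" "\<lambda>(k, tau). k # tau"])
        (auto simp: list_all2_Cons2)
    finally show ?case .
  qed
  also have "\<dots> = (\<Sum>k\<le>n. \<Sum>tau | tau \<in> ?B mu \<and> sum_list tau = k. ?h mu tau)"
    by (rule sum.group[symmetric])
      (use assms sum_list_comp_diff[of _ mu] in \<open>fastforce simp: finite_list_all2_le\<close>)+
  also have "\<dots> = (\<Sum>k\<le>n. var N ^ k *
    (\<Sum>tau\<in>sub_compositions mu k. scal (composition_weight t tau) * q_hat_part N t (comp_diff mu tau)))"
    unfolding sum_distrib_left
    by (intro sum.cong refl) (auto simp: sub_compositions_iff mult_ac)
  finally show ?thesis .
qed

lemma q_hat_part_monomial_sum:
  assumes "sum_list mu \<le> n"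
  shows "q_hat_part N t mu = monomial_sum n N (q_hat_coeff t mu)"
  using assms
proof (induction N arbitrary: mu)
  case 0
  have "q_hat_part 0 t mu = scal (composition_weight t mu)"
    by (induction mu) (simp_all add: q_hat_part_def composition_weight_def q_hat_no_variables scal_mult)
  then show ?case by simp
next
  case (Suc N)
  have "(\<Sum>tau\<in>sub_compositions mu k. scal (composition_weight t tau) * q_hat_part N t (comp_diff mu tau))
      = monomial_sum n N (\<lambda>ga. q_hat_coeff t mu (int k # ga))" for k
  proof -
    have "q_hat_part N t (comp_diff mu tau) = monomial_sum n N (q_hat_coeff t (comp_diff mu tau))"
      if "tau \<in> sub_compositions mu k" for tau
      using that Suc.prems sum_list_comp_diff[of tau mu]
      by (intro Suc.IH) (auto simp: sub_compositions_iff)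
    then show ?thesis by (simp add: monomial_sum_sum)
  qed
  then show ?case by (simp add: q_hat_part_Suc[OF Suc.prems])
qed

section \<open>Character values as Schur coefficients\<close>

definition nonzero_parts :: "nat list \<Rightarrow> nat list" where
  "nonzero_parts lam = filter (\<lambda>a. a \<noteq> 0) lam"

lemma nonzero_parts_append_zeros:
  assumes "sorted_wrt (\<ge>) lam"
  shows "lam = nonzero_parts lam @ replicate (length lam - length (nonzero_parts lam)) 0"
  using assms
proof (induction lam)
  case (Cons a lam)
  show ?case
  proof (cases "a = 0")
    case True
    with Cons.prems have "\<forall>x\<in>set (a # lam). x = 0" by auto
    then have "a # lam = replicate (length (a # lam)) 0" "nonzero_parts (a # lam) = []"
      by (auto simp: nonzero_parts_def intro: replicate_eqI)
    then show ?thesis by simp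
  next
    case False
    with Cons show ?thesis by (simp add: nonzero_parts_def)
  qed
qed (simp add: nonzero_parts_def)

lemma nonzero_parts_partition: "sorted_wrt (\<ge>) lam \<Longrightarrow> is_partition (nonzero_parts lam)"
  by (auto simp: is_partition_def nonzero_parts_def sorted_wrt_filter)

lemma nonzero_parts_append: "is_partition lam \<Longrightarrow> nonzero_parts (lam @ replicate k 0) = lam"
  by (auto simp: is_partition_def nonzero_parts_def intro: filter_True)

lemma sum_list_nonzero_parts: "sum_list (nonzero_parts lam) = sum_list lam"
  by (induction lam) (auto simp: nonzero_parts_def)

lemma schur_nonzero_parts:
  assumes "sorted_wrt (\<ge>) lam"
  shows "schur N (nonzero_parts lam) = schur N lam"
proof -
  have "diagram (xs @ replicate k 0) = diagram xs" for xs k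
    by (auto simp: diagram_def nth_append split: if_splits)
  then have "diagram (nonzero_parts lam) = diagram lam"
    using nonzero_parts_append_zeros[OF assms] by metis
  then show ?thesis by (simp add: schur_def ssyt_def)
qed

lemma schur_coeff_nonzero_parts:
  assumes "symmetric_coeffs f" "\<And>al. f (al @ [0]) = f al" "sorted_wrt (\<ge>) lam"
  shows "schur_coeff f (map int (nonzero_parts lam)) = schur_coeff f (map int lam)"
proof -
  have "schur_coeff f (map int (xs @ replicate k 0)) = schur_coeff f (map int xs)" for xs k
  proof (induction k)
    case (Suc k)
    have "map int (xs @ replicate (Suc k) 0) = map int (xs @ replicate k 0) @ [0]"
      by (simp flip: replicate_append_same)
    then show ?case using Suc schur_coeff_append_zero[OF assms(1,2)] by metis
  qed simp
  then show ?thesis using nonzero_parts_append_zeros[OF assms(3)] by metis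
qed

lemma length_le_sum_list: "is_partition lam \<Longrightarrow> length lam \<le> sum_list lam"
  by (induction lam) (auto simp: is_partition_def Suc_le_eq)

lemma finite_partitions: "finite (partitions k)"
proof (rule finite_subset[OF _ finite_lists_length_le[of "{..k}" k]])
  show "partitions k \<subseteq> {xs. set xs \<subseteq> {..k} \<and> length xs \<le> k}"
    using length_le_sum_list member_le_sum_list by (fastforce simp: partitions_def)
qed simp

lemma pad_partition:
  assumes "is_partition lam" "length lam \<le> N" "sum_list lam \<le> n"
  shows "lam @ replicate (N - length lam) 0 \<in> dec_lists N n"
proof -
  have "sorted_wrt (\<ge>) (replicate k (0 :: nat))" for k
    by (induction k) auto
  with assms show ?thesis
    by (auto simp: dec_lists_def is_partition_def sorted_wrt_append sum_list_replicate)
qed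

text \<open>Partitions with more than \<open>N\<close> parts contribute nothing in \<open>N\<close> variables, and the others
correspond to their padded forms.\<close>

lemma sum_partitions_dec_lists:
  "(\<Sum>k = 0..n. \<Sum>lam\<in>partitions k. scal (c lam) * schur N lam)
    = (\<Sum>lam\<in>dec_lists N n. scal (c (nonzero_parts lam)) * schur N lam)"
proof -
  let ?P = "{lam. is_partition lam \<and> sum_list lam \<le> n}"
  let ?g = "\<lambda>lam. scal (c lam) * schur N lam"
  have P: "?P = (\<Union>k\<in>{0..n}. partitions k)" by (auto simp: partitions_def)
  have fin: "finite ?P" unfolding P by (auto simp: finite_partitions)
  have "(\<Sum>k = 0..n. \<Sum>lam\<in>partitions k. ?g lam) = sum ?g ?P"
    unfolding P by (rule sum.UNION_disjoint[symmetric]) (auto simp: finite_partitions, auto simp: partitions_def)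
  also have "\<dots> = sum ?g {lam \<in> ?P. length lam \<le> N}"
  proof (rule sum.mono_neutral_right)
    show "\<forall>lam\<in>?P - {lam \<in> ?P. length lam \<le> N}. ?g lam = 0"
    proof
      fix lam assume "lam \<in> ?P - {lam \<in> ?P. length lam \<le> N}"
      then have "schur N lam = 0" by (intro schur_too_long) auto
      then show "?g lam = 0" by simp
    qed
  qed (use fin in auto)
  also have "\<dots> = (\<Sum>lam\<in>dec_lists N n. scal (c (nonzero_parts lam)) * schur N lam)"
  proof (rule sum.reindex_bij_witness[of _ nonzero_parts "\<lambda>lam. lam @ replicate (N - length lam) 0"], goal_cases)
    case (1 lam)
    then show ?case by (simp add: nonzero_parts_append)
  next
    case (2 lam)
    then show ?case using pad_partition by blast
  next
    case (3 lam)
    then show ?case using nonzero_parts_append_zeros[of lam] by (simp add: dec_lists_def)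
  next
    case (4 lam)
    then show ?case using nonzero_parts_partition[of lam] sum_list_nonzero_parts[of lam]
      by (auto simp: dec_lists_def nonzero_parts_def)
  next
    case (5 lam)
    then have "lam @ replicate (N - length lam) 0 \<in> dec_lists N n" using pad_partition by blast
    with 5 show ?case
      using schur_nonzero_parts[of "lam @ replicate (N - length lam) 0" N]
      by (simp add: dec_lists_def nonzero_parts_append)
  qed
  finally show ?thesis .
qed

definition frobenius_factor :: "nat list \<Rightarrow> cq" where
  "frobenius_factor mu = qq ^ sum_list mu / (qq - 1) ^ nz_len mu"

text \<open>The right-hand side satisfies the Frobenius formula for every number of variables by
\<open>schur_expansion\<close>.  It is the only solution: as many variables as \<open>mu\<close> has cells suffice to
separate all partitions of size at most \<open>|mu|\<close> by \<open>schur_linearly_independent\<close>.\<close>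

theorem rook_char_schur_coeff:
  assumes "is_partition lam" "sum_list lam \<le> sum_list mu"
  shows "rook_char lam mu
    = frobenius_factor mu * schur_coeff (q_hat_coeff (inverse qq) mu) (map int lam)"
proof -
  let ?f = "q_hat_coeff (inverse qq) mu"
  let ?n = "sum_list mu"
  define c0 where "c0 = (\<lambda>lam. if is_partition lam \<and> sum_list lam \<le> ?n
     then frobenius_factor mu * schur_coeff ?f (map int lam) else 0)"
  let ?P = "\<lambda>c. frobenius_formula mu c \<and> (\<forall>rho. \<not> (is_partition rho \<and> sum_list rho \<le> ?n) \<longrightarrow> c rho = 0)"
  have c0: "c0 (nonzero_parts lam) = frobenius_factor mu * schur_coeff ?f (map int lam)"
    if "lam \<in> dec_lists N ?n" for lam N
    using that nonzero_parts_partition[of lam]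
      schur_coeff_nonzero_parts[OF symmetric_q_hat_coeff q_hat_coeff_append_zero, of lam]
    by (auto simp: c0_def dec_lists_def sum_list_nonzero_parts)
  have frob: "(\<Sum>lam\<in>dec_lists N ?n. scal (c0 (nonzero_parts lam)) * schur N lam)
      = scal (frobenius_factor mu) * q_hat_part N (inverse qq) mu" for N
  proof -
    have "(\<Sum>lam\<in>dec_lists N ?n. scal (c0 (nonzero_parts lam)) * schur N lam)
       = scal (frobenius_factor mu) * (\<Sum>lam\<in>dec_lists N ?n. scal (schur_coeff ?f (map int lam)) * schur N lam)"
      unfolding sum_distrib_left by (intro sum.cong refl) (simp add: c0 scal_mult mult_ac)
    also have "(\<Sum>lam\<in>dec_lists N ?n. scal (schur_coeff ?f (map int lam)) * schur N lam) = monomial_sum ?n N ?f"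
      by (rule schur_expansion[OF symmetric_q_hat_coeff q_hat_coeff_degree])
    finally show ?thesis by (simp only: q_hat_part_monomial_sum[OF order.refl])
  qed
  have "?P c0"
    unfolding frobenius_formula_def sum_partitions_dec_lists frob
    by (auto simp: frobenius_factor_def c0_def)
  moreover have "c = c0" if "?P c" for c
  proof
    fix rho
    show "c rho = c0 rho"
    proof (cases "is_partition rho \<and> sum_list rho \<le> ?n")
      case True
      have "(\<Sum>lam\<in>dec_lists ?n ?n. scal (c (nonzero_parts lam) - c0 (nonzero_parts lam)) * schur ?n lam) = 0"
      proof -
        have "(\<Sum>lam\<in>dec_lists ?n ?n. scal (c (nonzero_parts lam)) * schur ?n lam)
            = (\<Sum>lam\<in>dec_lists ?n ?n. scal (c0 (nonzero_parts lam)) * schur ?n lam)"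
          using that unfolding frobenius_formula_def sum_partitions_dec_lists frob
          by (auto simp: frobenius_factor_def)
        then show ?thesis by (simp add: scal_def single_diff left_diff_distrib sum_subtractf)
      qed
      from schur_linearly_independent[OF this pad_partition[of rho]] True length_le_sum_list[of rho]
      show ?thesis by (simp add: nonzero_parts_append)
    next
      case False
      with that show ?thesis by (auto simp: c0_def)
    qed
  qed
  ultimately have "(THE c. ?P c) = c0" by (rule the_equality)
  with assms show ?thesis by (simp add: rook_char_def c0_def)
qed

text \<open>The Frobenius formula depends on \<open>mu\<close> only through the multiset of its nonzero parts, since
\<open>q_hat N t 0 = 1\<close>.\<close>

lemma rook_char_sort_to_partition: "rook_char nu (sort_to_partition xs) = rook_char nu xs"
proof -
  have m: "mset (sort_to_partition xs) = mset (filter (\<lambda>a. a \<noteq> 0) xs)"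
    by (simp add: sort_to_partition_def)
  have sum: "sum_list (sort_to_partition xs) = sum_list xs"
  proof -
    have "sum_list (sort_to_partition xs) = sum_mset (mset (sort_to_partition xs))"
      by (simp only: sum_mset_sum_list)
    also have "\<dots> = sum_list (nonzero_parts xs)"
      by (simp only: m sum_mset_sum_list nonzero_parts_def)
    finally show ?thesis by (simp only: sum_list_nonzero_parts)
  qed
  have len: "nz_len (sort_to_partition xs) = nz_len xs"
    using arg_cong[OF m, of "\<lambda>M. size (filter_mset (\<lambda>a. a \<noteq> 0) M)"]
    by (simp add: nz_len_def flip: mset_filter)
  have "q_hat_part N t (sort_to_partition xs) = q_hat_part N t (filter (\<lambda>a. a \<noteq> 0) xs)" for N t
  proof -
    have "q_hat_part N t ys = prod_mset (image_mset (q_hat N t) (mset ys))" for ys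
      by (induction ys) (auto simp: q_hat_part_def)
    then show ?thesis by (simp only: m)
  qed
  also have "q_hat_part N t (filter (\<lambda>a. a \<noteq> 0) xs) = q_hat_part N t xs" for N t
    by (induction xs) (auto simp: q_hat_part_def q_hat_def exp_series_nth_0)
  finally show ?thesis
    by (simp add: rook_char_def frobenius_formula_def sum len)
qed

section \<open>Row removal over vertical strips\<close>

definition drops :: "int list \<Rightarrow> int list set" where
  "drops al = {be. list_all2 (\<lambda>b a. b = a \<or> b = a - 1) be al}"

lemma drops_Cons: "drops (a # al) = (#) a ` drops al \<union> (#) (a - 1) ` drops al"
  by (auto simp: drops_def list_all2_Cons2)

lemma finite_drops: "finite (drops al)"
  by (induction al) (auto simp: drops_Cons, simp add: drops_def)

lemma drops_sum_le: "be \<in> drops al \<Longrightarrow> sum_list be \<le> sum_list al"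
  unfolding drops_def mem_Collect_eq by (induction rule: list_all2_induct) auto

lemma signed_drops_eq_sum:
  "signed_drops G al = (\<Sum>be\<in>drops al. (-1) ^ nat (sum_list al - sum_list be) * G (nat (sum_list al - sum_list be)) be)"
proof (induction al arbitrary: G)
  case Nil
  have "drops [] = {[]}" by (auto simp: drops_def)
  then show ?case by simp
next
  case (Cons a al)
  let ?h = "\<lambda>be. (-1) ^ nat (sum_list (a # al) - sum_list be) * G (nat (sum_list (a # al) - sum_list be)) be"
  have "(\<Sum>be\<in>drops (a # al). ?h be) = (\<Sum>be\<in>drops al. ?h (a # be)) + (\<Sum>be\<in>drops al. ?h ((a - 1) # be))"
    unfolding drops_Cons by (subst sum.union_disjoint) (auto simp: finite_drops sum.reindex)
  also have "(\<Sum>be\<in>drops al. ?h (a # be)) = signed_drops (\<lambda>i be. G i (a # be)) al"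
    unfolding Cons.IH by simp
  also have "(\<Sum>be\<in>drops al. ?h ((a - 1) # be)) = - signed_drops (\<lambda>i be. G (Suc i) ((a - 1) # be)) al"
    unfolding Cons.IH sum_negf[symmetric]
  proof (rule sum.cong[OF refl])
    fix be assume "be \<in> drops al"
    then have "nat (sum_list (a # al) - sum_list ((a - 1) # be)) = Suc (nat (sum_list al - sum_list be))"
      using drops_sum_le by fastforce
    then show "?h ((a - 1) # be) = - ((-1) ^ nat (sum_list al - sum_list be) *
        G (Suc (nat (sum_list al - sum_list be))) ((a - 1) # be))" by simp
  qed
  finally show ?case by simp
qed

text \<open>The partitions obtained from \<open>xs\<close> by removing a vertical strip, padded to the length
of \<open>xs\<close>.\<close>

definition vertical_lists :: "nat list \<Rightarrow> nat list set" where
  "vertical_lists xs = {nu. sorted_wrt (\<ge>) nu \<and> list_all2 (\<lambda>b a. b = a \<or> Suc b = a) nu xs}"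

text \<open>If lowering entries of a partition spoils the order of two neighbours, they were equal and
only the first was lowered; the exchange of the straightening rule then fixes the result, so
antisymmetric coefficients vanish on it.  Otherwise only negativity of the last entry can go wrong.\<close>

lemma drops_vertical_list:
  assumes "be \<in> drops (map int xs)" "sorted_wrt (\<ge>) xs"
    and "be \<notin> map int ` vertical_lists xs"
  shows "(\<exists>p x s. be = p @ (x - 1) # x # s) \<or> (\<exists>p x. be = p @ [x] \<and> x < 0)"
proof (cases "\<exists>i. Suc i < length be \<and> be ! i < be ! Suc i")
  case True
  then obtain i where i: "Suc i < length be" "be ! i < be ! Suc i" by blast
  have len: "length be = length xs" using assms(1) by (auto simp: drops_def dest: list_all2_lengthD)
  have "be ! j = int (xs ! j) \<or> be ! j = int (xs ! j) - 1" if "j < length be" for j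
    using assms(1) that by (auto simp: drops_def list_all2_conv_all_nth)
  from this[of i] this[of "Suc i"] have "be ! i = be ! Suc i - 1"
    using i len sorted_wrt_nth_less[OF assms(2), of i "Suc i"] by auto
  moreover have "be = take i be @ be ! i # be ! Suc i # drop (Suc (Suc i)) be"
    using i(1) by (simp add: Cons_nth_drop_Suc)
  ultimately show ?thesis by metis
next
  case False
  then have "be ! Suc i \<le> be ! i" if "Suc i < length be" for i
    using that not_less by blast
  then have "sorted_wrt (\<ge>) be"
    by (subst sorted_wrt_iff_nth_Suc_transp) (auto simp: transp_def)
  have "\<exists>x\<in>set be. x < 0"
  proof (rule ccontr)
    assume "\<not> ?thesis"
    then have be: "be = map int (map nat be)" by (auto intro!: map_idI[symmetric])
    have "sorted_wrt (\<ge>) (map nat be)"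
      using \<open>sorted_wrt (\<ge>) be\<close> by (auto simp: sorted_wrt_map elim!: sorted_wrt_mono_rel[rotated])
    moreover have "list_all2 (\<lambda>b a. b = a \<or> Suc b = a) (map nat be) xs"
      using assms(1) \<open>\<not> (\<exists>x\<in>set be. x < 0)\<close>
      by (fastforce simp: drops_def list_all2_conv_all_nth all_set_conv_all_nth not_less)
    ultimately have "map nat be \<in> vertical_lists xs" by (simp add: vertical_lists_def)
    with be assms(3) show False by blast
  qed
  then obtain x where x: "x \<in> set be" "x < 0" by blast
  then obtain p y where be: "be = p @ [y]" by (cases be rule: rev_cases) auto
  with x \<open>sorted_wrt (\<ge>) be\<close> have "y < 0" by (auto simp: sorted_wrt_append)
  with be show ?thesis by blast
qed

lemma sum_list_map_int: "sum_list (map int xs) = int (sum_list xs)"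
  by (induction xs) auto

lemma vertical_lists_sum_le: "nu \<in> vertical_lists xs \<Longrightarrow> sum_list nu \<le> sum_list xs"
  unfolding vertical_lists_def
  by clarify (drule list_all2_mono[of _ _ _ "(\<le>)"], auto dest!: sum_list_comp_diff)

lemma signed_drops_vertical:
  fixes G :: "nat \<Rightarrow> int list \<Rightarrow> 'a::{idom, ring_char_0}"
  assumes anti: "\<And>i p a b s. G i (p @ a # b # s) = - G i (p @ (b - 1) # (a + 1) # s)"
    and neg: "\<And>i p x. x < 0 \<Longrightarrow> G i (p @ [x]) = 0"
    and xs: "sorted_wrt (\<ge>) xs"
  shows "signed_drops G (map int xs)
    = (\<Sum>nu\<in>vertical_lists xs. (-1) ^ (sum_list xs - sum_list nu) * G (sum_list xs - sum_list nu) (map int nu))"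
proof -
  let ?h = "\<lambda>be. (-1) ^ nat (sum_list (map int xs) - sum_list be) *
    G (nat (sum_list (map int xs) - sum_list be)) be"
  have "signed_drops G (map int xs) = sum ?h (drops (map int xs))"
    by (rule signed_drops_eq_sum)
  also have "\<dots> = sum ?h (map int ` vertical_lists xs)"
  proof (rule sum.mono_neutral_right[OF finite_drops])
    show "map int ` vertical_lists xs \<subseteq> drops (map int xs)"
      by (force simp: vertical_lists_def drops_def list_all2_conv_all_nth)
    have "G i be = 0" if be: "be \<in> drops (map int xs)" "be \<notin> map int ` vertical_lists xs" for i be
    proof -
      from drops_vertical_list[OF be(1) xs be(2)] show ?thesis
      proof (elim disjE exE conjE)
        fix p x s assume "be = p @ (x - 1) # x # s"
        then show ?thesis
          using anti[of i p "x - 1" x s] by (intro eq_uminus_imp_zero) simp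
      next
        fix p x assume "be = p @ [x]" "x < 0"
        then show ?thesis using neg by simp
      qed
    qed
    then show "\<forall>be\<in>drops (map int xs) - map int ` vertical_lists xs. ?h be = 0" by simp
  qed
  also have "\<dots> = (\<Sum>nu\<in>vertical_lists xs. ?h (map int nu))"
    by (subst sum.reindex) (auto simp: inj_on_def intro: map_injective[of int] injI)
  also have "\<dots> = (\<Sum>nu\<in>vertical_lists xs. (-1) ^ (sum_list xs - sum_list nu) * G (sum_list xs - sum_list nu) (map int nu))"
    by (intro sum.cong refl) (simp add: sum_list_map_int nat_diff_distrib vertical_lists_sum_le flip: of_nat_diff)
  finally show ?thesis .
qed

lemma nth_default_nonzero_parts:
  assumes "sorted_wrt (\<ge>) nu"
  shows "nth_default 0 (nonzero_parts nu) i = nth_default 0 nu i"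
proof -
  have "nth_default 0 (ys @ replicate k 0) i = nth_default 0 ys i" for ys :: "nat list" and k
    by (auto simp: nth_default_def nth_append)
  then show ?thesis using nonzero_parts_append_zeros[OF assms] by metis
qed

lemma vertical_strip_iff:
  assumes "sorted_wrt (\<ge>) nu" "length nu = length xs"
  shows "vertical_strip xs (nonzero_parts nu) \<longleftrightarrow> list_all2 (\<lambda>b a. b = a \<or> Suc b = a) nu xs"
proof -
  have "vertical_strip xs (nonzero_parts nu) \<longleftrightarrow>
      (\<forall>i. nth_default 0 nu i = nth_default 0 xs i \<or> Suc (nth_default 0 nu i) = nth_default 0 xs i)"
    unfolding vertical_strip_def sub_diagram_def nth_default_nonzero_parts[OF assms(1)]
      all_conj_distrib[symmetric]
    by (intro arg_cong[of _ _ All] ext) auto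
  also have "\<dots> \<longleftrightarrow> list_all2 (\<lambda>b a. b = a \<or> Suc b = a) nu xs"
    using assms(2) by (auto simp: nth_default_def list_all2_conv_all_nth)
  finally show ?thesis .
qed

lemma sub_diagram_length:
  assumes "is_partition nu" "sub_diagram nu xs"
  shows "length nu \<le> length xs"
proof (rule ccontr)
  assume "\<not> ?thesis"
  then have "nth_default 0 nu (length xs) > 0"
    using assms(1) by (simp add: nth_default_def is_partition_def)
  moreover have "nth_default 0 xs (length xs) = 0" by (simp add: nth_default_def)
  ultimately show False using assms(2) by (metis not_le sub_diagram_def)
qed

lemma sum_vertical_lists:
  "(\<Sum>nu\<in>vertical_lists xs. F (nonzero_parts nu))
     = (\<Sum>nu | is_partition nu \<and> vertical_strip xs nu. F nu)"
proof (rule sum.reindex_bij_witness[of _ "\<lambda>nu. nu @ replicate (length xs - length nu) 0" nonzero_parts], goal_cases)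
  case (1 nu)
  then show ?case using nonzero_parts_append_zeros[of nu]
    by (auto simp: vertical_lists_def dest!: list_all2_lengthD)
next
  case (2 nu)
  then have "length nu = length xs" by (auto simp: vertical_lists_def dest: list_all2_lengthD)
  with 2 show ?case
    by (auto simp: vertical_lists_def vertical_strip_iff nonzero_parts_partition)
next
  case (3 nu)
  then show ?case by (simp add: nonzero_parts_append)
next
  case (4 nu)
  then have nu: "is_partition nu" "vertical_strip xs nu" by auto
  then have "length nu \<le> length xs" by (intro sub_diagram_length) (auto simp: vertical_strip_def)
  let ?nu = "nu @ replicate (length xs - length nu) 0"
  have "?nu \<in> dec_lists (length xs) (sum_list nu)"
    using nu \<open>length nu \<le> length xs\<close> by (intro pad_partition) auto
  then have "sorted_wrt (\<ge>) ?nu" "length ?nu = length xs" by (auto simp: dec_lists_def)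
  moreover have "vertical_strip xs (nonzero_parts ?nu)"
    using nu by (simp add: nonzero_parts_append)
  ultimately show ?case using vertical_strip_iff by (simp add: vertical_lists_def)
qed simp

text \<open>Row removal for partitions: of the \<open>2\<^sup>r\<close> terms of the recursion only those indexed by
partitions survive, and the partitions among \<open>xs - \<epsilon>\<close> are those differing from \<open>xs\<close> by a vertical strip.\<close>

theorem schur_coeff_row_removal:
  fixes f :: "int list \<Rightarrow> 'a::{idom, ring_char_0}"
  assumes f: "symmetric_coeffs f" "\<And>al. f (al @ [0]) = f al" and xs: "sorted_wrt (\<ge>) xs"
  shows "schur_coeff f (map int (a # xs)) =
    (\<Sum>nu | is_partition nu \<and> vertical_strip xs nu. (-1) ^ (sum_list xs - sum_list nu) *
       schur_coeff (\<lambda>ga. f (int (a + sum_list xs - sum_list nu) # ga)) (map int nu))"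
proof -
  have "schur_coeff f (map int (a # xs))
    = signed_drops (\<lambda>i be. schur_coeff (\<lambda>ga. f ((int a + int i) # ga)) be) (map int xs)" by simp
  also have "\<dots> = (\<Sum>nu\<in>vertical_lists xs. (-1) ^ (sum_list xs - sum_list nu) *
      schur_coeff (\<lambda>ga. f ((int a + int (sum_list xs - sum_list nu)) # ga)) (map int nu))"
    by (rule signed_drops_vertical)
      (auto intro: schur_coeff_antisymmetric schur_coeff_neg_last symmetric_coeffs_Cons[OF f(1)] xs)
  also have "\<dots> = (\<Sum>nu\<in>vertical_lists xs. (-1) ^ (sum_list xs - sum_list (nonzero_parts nu)) *
      schur_coeff (\<lambda>ga. f (int (a + sum_list xs - sum_list (nonzero_parts nu)) # ga)) (map int (nonzero_parts nu)))"
  proof (rule sum.cong[OF refl])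
    fix nu assume nu: "nu \<in> vertical_lists xs"
    let ?g = "\<lambda>ga. f ((int a + int (sum_list xs - sum_list nu)) # ga)"
    have "f (c # al @ [0]) = f (c # al)" for c al using f(2)[of "c # al"] by simp
    then have "schur_coeff ?g (map int (nonzero_parts nu)) = schur_coeff ?g (map int nu)"
      using nu by (intro schur_coeff_nonzero_parts symmetric_coeffs_Cons f(1)) (auto simp: vertical_lists_def)
    moreover have "int a + int (sum_list xs - sum_list nu) = int (a + sum_list xs - sum_list nu)"
      using vertical_lists_sum_le[OF nu] by simp
    ultimately show "(-1) ^ (sum_list xs - sum_list nu) * schur_coeff ?g (map int nu)
      = (-1) ^ (sum_list xs - sum_list (nonzero_parts nu)) *
      schur_coeff (\<lambda>ga. f (int (a + sum_list xs - sum_list (nonzero_parts nu)) # ga)) (map int (nonzero_parts nu))"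
      by (simp only: sum_list_nonzero_parts)
  qed
  also have "\<dots> = (\<Sum>nu | is_partition nu \<and> vertical_strip xs nu. (-1) ^ (sum_list xs - sum_list nu) *
       schur_coeff (\<lambda>ga. f (int (a + sum_list xs - sum_list nu) # ga)) (map int nu))"
    by (rule sum_vertical_lists)
  finally show ?thesis .
qed

lemma qq_nonzero: "qq \<noteq> 0" and qq_minus_1_nonzero: "qq - 1 \<noteq> 0"
  by (auto simp: qq_def Zero_fract_def One_fract_def eq_fract one_pCons)

text \<open>With \<open>t = 1/q\<close> each nonzero entry of \<open>\<tau>\<close> has weight \<open>1 - t = (q - 1)/q\<close>.  Together with the
change of the normalising factor from \<open>\<mu>\<close> to \<open>\<mu> - \<tau>\<close> this gives the powers of \<open>q\<close> and \<open>q - 1\<close> in the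
recurrence.\<close>

lemma frobenius_factor_comp_diff:
  assumes "list_all2 (\<le>) tau mu"
  shows "frobenius_factor mu * composition_weight (inverse qq) tau =
    qq powi (int (sum_list tau) - int (nz_len tau)) /
     (qq - 1) powi (int (nz_len mu) - int (nz_len tau) - int (nz_len (comp_diff mu tau)))
     * frobenius_factor (comp_diff mu tau)"
proof -
  have w: "1 - inverse qq = (qq - 1) / qq"
    using qq_nonzero by (simp add: field_simps)
  have s: "sum_list mu = sum_list (comp_diff mu tau) + sum_list tau"
    using sum_list_comp_diff[OF assms] by simp
  show ?thesis
    using qq_nonzero qq_minus_1_nonzero
    unfolding frobenius_factor_def composition_weight_power w s
    by (simp add: power_int_diff power_int_add power_add power_divide field_simps)
qed

theorem theorem3p3:
  fixes n m :: nat and lam mu :: "nat list"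
  assumes "mu \<in> partitions n" and "lam \<in> partitions m" and "m \<le> n"
  shows "rook_char lam mu =
    (\<Sum>nu\<in>{nu. is_partition nu \<and> vertical_strip (tl lam) nu}.
      \<Sum>tau\<in>sub_compositions mu (m - sum_list nu).
        (-1) powi (int m - int (sum_list nu) - int (nth_default 0 lam 0)) *
        (qq powi (int m - int (sum_list nu) - int (nz_len tau)) /
         (qq - 1) powi (int (nz_len mu) - int (nz_len tau) - int (nz_len (comp_diff mu tau)))) *
        rook_char nu (sort_to_partition (comp_diff mu tau)))"
proof -
  let ?f = "q_hat_coeff (inverse qq) mu"
  let ?a = "nth_default 0 lam 0" and ?xs = "tl lam"
  have lam: "is_partition lam" "sum_list lam = m" and n: "sum_list mu = n"
    using assms by (auto simp: partitions_def)
  have m: "m = ?a + sum_list ?xs" and xs: "sorted_wrt (\<ge>) ?xs"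
    using lam by (cases lam; simp add: is_partition_def nth_default_def)+
  \<comment> \<open>For the empty partition, \<open>?a # ?xs\<close> is a single zero row, which stability adds.\<close>
  have "schur_coeff ?f (map int lam) = schur_coeff ?f (map int (?a # ?xs))"
  proof (cases lam)
    case Nil
    then show ?thesis
      using schur_coeff_append_zero[OF symmetric_q_hat_coeff q_hat_coeff_append_zero, of _ mu "[]"]
      by (simp add: nth_default_def)
  qed (simp add: nth_default_def)
  then have "rook_char lam mu = frobenius_factor mu * schur_coeff ?f (map int (?a # ?xs))"
    using rook_char_schur_coeff[of lam mu] lam n assms(3) by simp
  also have "\<dots> = (\<Sum>nu | is_partition nu \<and> vertical_strip ?xs nu. frobenius_factor mu *
      ((-1) ^ (sum_list ?xs - sum_list nu) * schur_coeff (\<lambda>ga. ?f (int (m - sum_list nu) # ga)) (map int nu)))"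
    unfolding schur_coeff_row_removal[OF symmetric_q_hat_coeff q_hat_coeff_append_zero xs] m[symmetric]
    by (rule sum_distrib_left)
  also have "\<dots> = (\<Sum>nu\<in>{nu. is_partition nu \<and> vertical_strip (tl lam) nu}.
      \<Sum>tau\<in>sub_compositions mu (m - sum_list nu).
        (-1) powi (int m - int (sum_list nu) - int ?a) *
        (qq powi (int m - int (sum_list nu) - int (nz_len tau)) /
         (qq - 1) powi (int (nz_len mu) - int (nz_len tau) - int (nz_len (comp_diff mu tau)))) *
        rook_char nu (sort_to_partition (comp_diff mu tau)))"
  proof (rule sum.cong[OF refl])
    fix nu assume "nu \<in> {nu. is_partition nu \<and> vertical_strip ?xs nu}"
    then have nu: "is_partition nu" "vertical_strip ?xs nu" by auto
    have le: "sum_list nu \<le> sum_list ?xs"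
    proof -
      have "length nu \<le> length ?xs" using nu by (intro sub_diagram_length) (auto simp: vertical_strip_def)
      then have "sum_list nu = (\<Sum>i<length ?xs. nth_default 0 nu i)"
        by (simp add: sum_list_sum_nth atLeast0LessThan)
          (rule sum.mono_neutral_cong_left, auto simp: nth_default_def)
      also have "\<dots> \<le> (\<Sum>i<length ?xs. nth_default 0 ?xs i)"
        using nu(2) by (intro sum_mono) (auto simp: vertical_strip_def sub_diagram_def)
      also have "\<dots> = sum_list ?xs"
        by (simp add: sum_list_sum_nth atLeast0LessThan nth_default_def)
      finally show ?thesis .
    qed
    have sign: "(-1) powi (int m - int (sum_list nu) - int ?a) = ((-1) ^ (sum_list ?xs - sum_list nu) :: cq)"
    proof -
      have "int m - int (sum_list nu) - int ?a = int (sum_list ?xs - sum_list nu)"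
        using le m by simp
      then show ?thesis by (simp only: power_int_of_nat)
    qed
    have coeff: "schur_coeff (\<lambda>ga. ?f (int (m - sum_list nu) # ga)) (map int nu)
      = (\<Sum>tau\<in>sub_compositions mu (m - sum_list nu). composition_weight (inverse qq) tau *
          schur_coeff (q_hat_coeff (inverse qq) (comp_diff mu tau)) (map int nu))"
      by (simp add: schur_coeff_sum)
    show "frobenius_factor mu * ((-1) ^ (sum_list ?xs - sum_list nu) *
        schur_coeff (\<lambda>ga. ?f (int (m - sum_list nu) # ga)) (map int nu))
      = (\<Sum>tau\<in>sub_compositions mu (m - sum_list nu).
        (-1) powi (int m - int (sum_list nu) - int ?a) *
        (qq powi (int m - int (sum_list nu) - int (nz_len tau)) /
         (qq - 1) powi (int (nz_len mu) - int (nz_len tau) - int (nz_len (comp_diff mu tau)))) *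
        rook_char nu (sort_to_partition (comp_diff mu tau)))"
      unfolding coeff sign sum_distrib_left
    proof (rule sum.cong[OF refl])
      fix tau assume "tau \<in> sub_compositions mu (m - sum_list nu)"
      then have tau: "list_all2 (\<le>) tau mu" "sum_list tau = m - sum_list nu"
        by (auto simp: sub_compositions_iff)
      then have "sum_list nu \<le> sum_list (comp_diff mu tau)"
        using sum_list_comp_diff[OF tau(1)] n le m assms(3) by linarith
      then have chi: "rook_char nu (sort_to_partition (comp_diff mu tau)) = frobenius_factor (comp_diff mu tau) *
          schur_coeff (q_hat_coeff (inverse qq) (comp_diff mu tau)) (map int nu)"
        unfolding rook_char_sort_to_partition by (intro rook_char_schur_coeff nu(1))
      have e: "int m - int (sum_list nu) - int (nz_len tau) = int (sum_list tau) - int (nz_len tau)"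
        using le m tau(2) by linarith
      show "frobenius_factor mu * ((-1) ^ (sum_list ?xs - sum_list nu) * (composition_weight (inverse qq) tau *
          schur_coeff (q_hat_coeff (inverse qq) (comp_diff mu tau)) (map int nu)))
        = (-1) ^ (sum_list ?xs - sum_list nu) *
        (qq powi (int m - int (sum_list nu) - int (nz_len tau)) /
         (qq - 1) powi (int (nz_len mu) - int (nz_len tau) - int (nz_len (comp_diff mu tau)))) *
        rook_char nu (sort_to_partition (comp_diff mu tau))"
        (is "_ * (?s * (_ * ?c)) = _")
      proof -
        have "frobenius_factor mu * (?s * (composition_weight (inverse qq) tau * ?c))
            = ?s * (frobenius_factor mu * composition_weight (inverse qq) tau) * ?c"
          by (simp only: mult_ac)
        then show ?thesis
          unfolding chi e frobenius_factor_comp_diff[OF tau(1)] by (simp only: mult_ac)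
      qed
    qed
  qed
  finally show ?thesis .
qed

end
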